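(* Let $n\ge 4$ and let $C_n$ be the cycle graph on $n$ nodes. Then the pure discrete Morse complex $\mathfrak{M}_{\mathrm{pure}}(C_n)$ is homotopy equivalent to $\mathbb{S}^2\vee\mathbb{S}^{n-2}\vee\mathbb{S}^{n-2}$.
   Context: A graph is regarded as a one-dimensional simplicial complex. For a finite simplicial complex $\Delta$, its Hasse diagram is the graph whose vertices are the nonempty faces of $\Delta$, with an edge $\{f,g\}$ whenever $f\subset g$ and $\dim g=\dim f+1$. A matching $M$ of the Hasse diagram is acyclic if orienting every edge from the larger face to the smaller one, except edges of $M$ which are oriented from smaller to larger, yields a directed graph without directed cycles. The discrete Morse complex $\mathfrak{M}(\Delta)$ is the simplicial complex whose vertex set is the set of edges of the Hasse diagram and whose faces are the acyclic matchings. The pure discrete Morse complex $\mathfrak{M}_{\mathrm{pure}}(\Delta)$ is the subcomplex of $\mathfrak{M}(\Delta)$ generated by the facets of maximal dimension. $\mathbb{S}^k$ denotes the $k$-sphere and $\vee$ the wedge. *)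

theory Defs
  imports "HOL-Analysis.Analysis"
begin

text \<open>
  A complex is given by its set of faces. The empty face belongs to every nonempty complex, and
  the dimension of a face \<open>F\<close> is \<open>card F - 1\<close>.
\<close>

definition finite_complex :: "'a set set \<Rightarrow> bool" where
  "finite_complex K \<longleftrightarrow>
     finite K \<and> (\<forall>F\<in>K. finite F) \<and> (\<forall>F\<in>K. \<forall>G. G \<subseteq> F \<longrightarrow> G \<in> K)"

definition facets :: "'a set set \<Rightarrow> 'a set set" where
  "facets K = {F \<in> K. \<forall>G\<in>K. F \<subseteq> G \<longrightarrow> G = F}"

definition pure_part :: "'a set set \<Rightarrow> 'a set set" where
  "pure_part K =
     {F. \<exists>G\<in>facets K. (\<forall>H\<in>facets K. card H \<le> card G) \<and> F \<subseteq> G}"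

text \<open>
  Geometric realization by barycentric coordinates. The product topology is the usual topology
  of the realization only for finite complexes.
\<close>

definition geometric_realization :: "'a set set \<Rightarrow> ('a \<Rightarrow> real) topology" where
  "geometric_realization K =
     subtopology (powertop_real UNIV)
       {x. (\<forall>v. 0 \<le> x v) \<and> {v. x v \<noteq> 0} \<in> K \<and> (\<Sum>v | x v \<noteq> 0. x v) = 1}"

definition hasse_edges :: "'a set set \<Rightarrow> 'a set set set" where
  "hasse_edges K =
     {{f, g} |f g. f \<in> K \<and> g \<in> K \<and> f \<noteq> {} \<and> f \<subset> g \<and> card g = Suc (card f)}"

definition hasse_matching :: "'a set set \<Rightarrow> 'a set set set \<Rightarrow> bool" where
  "hasse_matching K M \<longleftrightarrow> M \<subseteq> hasse_edges K \<and> pairwise disjnt M"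

definition hasse_orientation :: "'a set set \<Rightarrow> 'a set set set \<Rightarrow> ('a set \<times> 'a set) set" where
  "hasse_orientation K M =
     {(a, b). {a, b} \<in> hasse_edges K \<and> (if {a, b} \<in> M then a \<subset> b else b \<subset> a)}"

definition morse_complex :: "'a set set \<Rightarrow> 'a set set set set" where
  "morse_complex K = {M. hasse_matching K M \<and> acyclic (hasse_orientation K M)}"

definition pure_morse_complex :: "'a set set \<Rightarrow> 'a set set set set" where
  "pure_morse_complex K = pure_part (morse_complex K)"

text \<open>The cycle graph on the nodes \<open>0, \<dots>, n - 1\<close> as a complex (meaningful for \<open>n \<ge> 3\<close>).\<close>

definition cycle_complex :: "nat \<Rightarrow> nat set set" where
  "cycle_complex n = {{}} \<union> {{i} |i. i < n} \<union> {{i, Suc i mod n} |i. i < n}"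

definition quotient_topology :: "'a topology \<Rightarrow> ('a \<Rightarrow> 'b) \<Rightarrow> 'b topology" where
  "quotient_topology X q =
     topology (\<lambda>U. U \<subseteq> q ` topspace X \<and> openin X {x \<in> topspace X. q x \<in> U})"

text \<open>\<open>None\<close> is the point to which all the base points \<open>p i\<close> are identified.\<close>

definition wedge_sum :: "'i set \<Rightarrow> ('i \<Rightarrow> 'a topology) \<Rightarrow> ('i \<Rightarrow> 'a) \<Rightarrow> ('i \<times> 'a) option topology" where
  "wedge_sum I X p =
     quotient_topology (sum_topology X I) (\<lambda>(i, x). if x = p i then None else Some (i, x))"

text \<open>
  \<open>nsphere d\<close> is the unit sphere of dimension \<open>d\<close>, realized in \<open>nat \<Rightarrow> real\<close> with vanishing
  coordinates beyond \<open>d\<close>; hence one base point serves for all dimensions.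
\<close>

definition pole :: "nat \<Rightarrow> real" where
  "pole j = (if j = 0 then 1 else 0)"

definition wedge_of_spheres :: "nat list \<Rightarrow> (nat \<times> (nat \<Rightarrow> real)) option topology" where
  "wedge_of_spheres ds = wedge_sum {..<length ds} (\<lambda>i. nsphere (ds ! i)) (\<lambda>_. pole)"

lemma finite_complex_cycle_complex:
  assumes "n \<ge> 1"
  shows "finite_complex (cycle_complex n)"
proof -
  have "G \<in> cycle_complex n" if F: "F \<in> cycle_complex n" and G: "G \<subseteq> F" for F G
  proof -
    have empty: "{} \<in> cycle_complex n"
      unfolding cycle_complex_def by blast
    have vertex: "{i} \<in> cycle_complex n" if "i < n" for i
      using that unfolding cycle_complex_def by blast
    consider "F = {}" | i where "i < n" "F = {i}" | i where "i < n" "F = {i, Suc i mod n}"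
      using F unfolding cycle_complex_def by blast
    then show ?thesis
    proof cases
      case 1
      then show ?thesis using G empty by simp
    next
      case 2
      then have "G = {} \<or> G = F"
        using G by (simp add: subset_singleton_iff)
      then show ?thesis using F empty by metis
    next
      case 3
      have "Suc i mod n < n"
        using assms by simp
      moreover have "G = {} \<or> G = {i} \<or> G = {Suc i mod n} \<or> G = F"
        using G 3(2) by blast
      ultimately show ?thesis
        using F vertex empty 3(1) by metis
    qed
  qed
  moreover have "finite (cycle_complex n)"
    by (simp add: cycle_complex_def)
  moreover have "finite F" if "F \<in> cycle_complex n" for F
    using that by (auto simp: cycle_complex_def)
  ultimately show ?thesis
    unfolding finite_complex_def by blast
qed

lemma acyclic_descending: "acyclic {(a, b). P a b \<and> b \<subset> a}"
proof -
  have "b \<subset> a" if "(a, b) \<in> {(a, b). P a b \<and> b \<subset> a}\<^sup>+" for a b :: "'a set"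
    using that
  proof (induction rule: trancl_induct)
    case (base b)
    then show ?case by simp
  next
    case (step b c)
    then have "c \<subset> b" by simp
    then show ?case using step.IH by (rule psubset_trans)
  qed
  then show ?thesis
    unfolding acyclic_def by blast
qed

lemma empty_in_morse_complex: "{} \<in> morse_complex K"
  using acyclic_descending[of "\<lambda>a b. {a, b} \<in> hasse_edges K"]
  by (simp add: morse_complex_def hasse_matching_def hasse_orientation_def)

lemma istopology_quotient:
  "istopology (\<lambda>U. U \<subseteq> q ` topspace X \<and> openin X {x \<in> topspace X. q x \<in> U})"
proof -
  have "openin X {x \<in> topspace X. q x \<in> S \<inter> T}"
    if "openin X {x \<in> topspace X. q x \<in> S}" "openin X {x \<in> topspace X. q x \<in> T}" for S T
  proof -
    have "{x \<in> topspace X. q x \<in> S \<inter> T} =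
        {x \<in> topspace X. q x \<in> S} \<inter> {x \<in> topspace X. q x \<in> T}"
      by auto
    then show ?thesis
      using that by (simp add: openin_Int)
  qed
  moreover have "openin X {x \<in> topspace X. q x \<in> \<Union>\<K>}"
    if "\<forall>K\<in>\<K>. openin X {x \<in> topspace X. q x \<in> K}" for \<K>
  proof -
    have "{x \<in> topspace X. q x \<in> \<Union>\<K>} = (\<Union>K\<in>\<K>. {x \<in> topspace X. q x \<in> K})"
      by auto
    then show ?thesis
      using that by (metis (no_types, lifting) imageE openin_Union)
  qed
  ultimately show ?thesis
    unfolding istopology_def by blast
qed

lemma openin_quotient_topology:
  "openin (quotient_topology X q) U \<longleftrightarrow>
     U \<subseteq> q ` topspace X \<and> openin X {x \<in> topspace X. q x \<in> U}"
  by (simp add: quotient_topology_def istopology_quotient)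

lemma quotient_map_quotient_topology: "quotient_map X (quotient_topology X q) q"
proof -
  have "openin (quotient_topology X q) (q ` topspace X)"
  proof -
    have "{x \<in> topspace X. q x \<in> q ` topspace X} = topspace X"
      by auto
    then show ?thesis
      by (simp add: openin_quotient_topology)
  qed
  then have "topspace (quotient_topology X q) = q ` topspace X"
    by (meson openin_quotient_topology openin_subset openin_topspace subset_antisym)
  then show ?thesis
    unfolding quotient_map_def openin_quotient_topology by simp
qed

lemma pole_in_nsphere: "pole \<in> topspace (nsphere d)"
  by (simp add: nsphere pole_def if_distrib[of "\<lambda>x. x ^ 2"] sum.delta cong: if_cong)

end

theory Submission
  imports Defs
begin

text \<open>
  The Hasse diagram of \<open>C\<^sub>n\<close> is a cycle of length \<open>2 n\<close>. Its two perfect matchings, even and odd,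
  are its only matchings that are not acyclic, and the acyclic matchings of maximal size \<open>n - 1\<close>
  are the perfect matchings with one edge removed and the unions of an arc of even edges with
  all odd edges not adjacent to it. So the pure complex consists of the boundaries of the even and
  the odd simplex and of mixed faces, which connect the two along a circle.

  The only topological tool is a collapse: if every face of \<open>K\<close> that contains \<open>\<rho>\<close> can be extended
  by \<open>v\<close>, then the open star of \<open>\<rho>\<close> can be removed. By collapses and their inverses the mixed
  faces are first made thin, then a circle of new nodes (\<open>Mid\<close>) is inserted between the even and
  the odd side, and each of the two halves is pulled off its simplex boundary, where it is
  null-homotopic, onto a new node (\<open>Top\<close>, \<open>Bot\<close>). The suspended circle is reduced to the boundary
  of a tetrahedron, and finally the three simplex boundaries are made to meet in the node \<open>Top\<close>.
\<close>

subsection \<open>Collapses of geometric realizations\<close>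

text \<open>A homotopy that slides one part of a complex along another is expressed by a larger
  complex that collapses onto both positions; therefore the chain alternates between collapses and
  expansions, and all conditions to be checked concern finite sets. Arcs are shortened to at most
  two nodes because \<open>Mid k\<close> is a copy of \<open>Odd k\<close>: with longer arcs the
  \<open>Mid\<close> nodes would span simplices of higher dimension, with thin arcs they span just
  the cycle graph. The even side of the circle is null-homotopic because a thin face misses two
  consecutive even indices, hence lies in the closed star of \<open>Even 0\<close>, that is, in the
  simplex boundary without the facet opposite to \<open>Even 0\<close>, a ball. On the odd side at
  most two odd nodes occur, which together with \<open>Odd 0\<close> do not exhaust
  \<open>n \<ge> 4\<close> nodes. The same bound leaves an even node that is compatible with two
  consecutive \<open>Mid\<close> nodes. The boundaries of simplices with \<open>n\<close> nodes give
  the spheres of dimension \<open>n - 2\<close>, and the suspension of the circle gives the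
  2-sphere, whatever \<open>n\<close> is.\<close>

lemma finite_complex_mono: "finite_complex K \<Longrightarrow> F \<in> K \<Longrightarrow> G \<subseteq> F \<Longrightarrow> G \<in> K"
  unfolding finite_complex_def by blast

lemma finite_complex_finite_face: "finite_complex K \<Longrightarrow> F \<in> K \<Longrightarrow> finite F"
  unfolding finite_complex_def by blast

lemma topspace_geometric_realization:
  "topspace (geometric_realization K) =
     {x. (\<forall>v. 0 \<le> x v) \<and> {v. x v \<noteq> 0} \<in> K \<and> (\<Sum>v | x v \<noteq> 0. x v) = 1}"
  by (simp add: geometric_realization_def)

lemma in_geometric_realization:
  assumes "finite S" "{v. x v \<noteq> 0} \<subseteq> S"
  shows "x \<in> topspace (geometric_realization K) \<longleftrightarrow>
    (\<forall>v. 0 \<le> x v) \<and> {v. x v \<noteq> 0} \<in> K \<and> sum x S = 1"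
proof -
  have "(\<Sum>v | x v \<noteq> 0. x v) = sum x S"
    using assms by (intro sum.mono_neutral_left) auto
  then show ?thesis
    by (simp add: topspace_geometric_realization)
qed

lemma continuous_map_into_geometric_realization:
  assumes "\<And>v. continuous_map X euclideanreal (\<lambda>x. f x v)"
    and "f \<in> topspace X \<rightarrow> topspace (geometric_realization K)"
  shows "continuous_map X (geometric_realization K) f"
  using assms
  by (simp add: geometric_realization_def continuous_map_in_subtopology
      continuous_map_componentwise_UNIV)

lemma continuous_map_geometric_realization_coordinate:
  "continuous_map (geometric_realization K) euclideanreal (\<lambda>x. x v)"
  unfolding geometric_realization_def
  by (blast intro: continuous_map_from_subtopology [OF continuous_map_product_projection])

lemma Hausdorff_geometric_realization: "Hausdorff_space (geometric_realization K)"
  unfolding geometric_realization_def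
  by (intro Hausdorff_space_subtopology) (simp add: Hausdorff_space_product_topology)

lemma INF_finite_pos_iff:
  fixes x :: "'a \<Rightarrow> real"
  assumes "finite A" "A \<noteq> {}"
  shows "0 < (INF u\<in>A. x u) \<longleftrightarrow> (\<forall>u\<in>A. 0 < x u)"
  using assms by (simp add: cInf_eq_Min)

lemma INF_finite_attained:
  fixes x :: "'a \<Rightarrow> real"
  assumes "finite A" "A \<noteq> {}"
  obtains u where "u \<in> A" "(INF u\<in>A. x u) = x u"
proof -
  have "Min (x ` A) \<in> x ` A"
    using assms by (intro Min_in) auto
  then obtain u where "u \<in> A" "Min (x ` A) = x u"
    by blast
  then show thesis
    using assms that by (simp add: cInf_eq_Min)
qed

lemma INF_finite_le:
  fixes x :: "'a \<Rightarrow> real"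
  assumes "finite A" "u \<in> A"
  shows "(INF u\<in>A. x u) \<le> x u"
  using assms by (intro cINF_lower bdd_below_finite) auto

text \<open>
  The mass that a point has in excess on all of \<open>\<rho>\<close> is moved to \<open>v\<close> until some coordinate in
  \<open>\<rho>\<close> vanishes.
\<close>

proposition homotopy_equivalent_remove_star:
  fixes K :: "'a set set"
  assumes K: "finite_complex K" and rho: "\<rho> \<in> K" "\<rho> \<noteq> {}" "v \<notin> \<rho>"
    and cone: "\<And>F. F \<in> K \<Longrightarrow> \<rho> \<subseteq> F \<Longrightarrow> insert v F \<in> K"
  shows "geometric_realization K homotopy_equivalent_space
    geometric_realization {F \<in> K. \<not> \<rho> \<subseteq> F}"
proof -
  let ?X = "geometric_realization K" and ?Y = "geometric_realization {F \<in> K. \<not> \<rho> \<subseteq> F}"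
  \<comment> \<open>The direction \<open>c\<close> takes one unit from each node of
    \<open>\<rho>\<close> and gives all \<open>card \<rho>\<close> units to \<open>v\<close>, so its
    coordinates sum to 0. At time \<open>t\<close> the amount taken from each node is
    \<open>t * m x\<close>.\<close>
  define c where "c u = (if u = v then real (card \<rho>) else if u \<in> \<rho> then -1 else 0)" for u
  define m where "m x = (INF u\<in>\<rho>. x u)" for x :: "'a \<Rightarrow> real"
  define h where "h t x = (\<lambda>u. x u + t * m x * c u)" for t :: real and x :: "'a \<Rightarrow> real"
  have fin: "finite \<rho>"
    using K rho(1) by (rule finite_complex_finite_face)
  have supp: "{u. x u \<noteq> 0} \<in> K" "finite {u. x u \<noteq> 0}" and nonneg: "0 \<le> x u"
    if "x \<in> topspace ?X" for x u
    using that finite_complex_finite_face[OF K] by (auto simp: topspace_geometric_realization)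
  \<comment> \<open>Outside the open star of \<open>\<rho>\<close> nothing moves; this makes
    \<open>h 1\<close> a retraction.\<close>
  have m0: "m x = 0" if "x \<in> topspace ?X" "\<not> \<rho> \<subseteq> {u. x u \<noteq> 0}" for x
  proof -
    have "\<not> 0 < m x"
      unfolding m_def using that(2) by (subst INF_finite_pos_iff) (use fin rho in force)+
    moreover have "0 \<le> m x"
      unfolding m_def using nonneg[OF that(1)] rho by (intro cINF_greatest) auto
    ultimately show ?thesis by simp
  qed
  have mpos: "0 \<le> m x" if "x \<in> topspace ?X" for x
    unfolding m_def using nonneg[OF that(1)] rho by (intro cINF_greatest) auto
  have mle: "m x \<le> x u" if "u \<in> \<rho>" for x u
    unfolding m_def using fin that by (rule INF_finite_le)
  have supp_h: "{u. h t x u \<noteq> 0} \<in> K" if x: "x \<in> topspace ?X" for t x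
  proof (cases "\<rho> \<subseteq> {u. x u \<noteq> 0}")
    case True
    then have "{u. h t x u \<noteq> 0} \<subseteq> insert v {u. x u \<noteq> 0}"
      by (auto simp: h_def c_def split: if_splits)
    then show ?thesis
      using finite_complex_mono[OF K] cone[OF supp(1)[OF x] True] by blast
  next
    case False
    then show ?thesis using m0[OF x False] supp[OF x] by (simp add: h_def)
  qed
  have sum_c: "sum c S = 0" if "finite S" "insert v \<rho> \<subseteq> S" for S
  proof -
    have "sum c S = sum c (insert v \<rho>)"
      using that by (intro sum.mono_neutral_right) (auto simp: c_def)
    also have "\<dots> = real (card \<rho>) + (\<Sum>u\<in>\<rho>. -1)"
    proof -
      have "sum c \<rho> = (\<Sum>u\<in>\<rho>. -1)"
        using rho(3) by (intro sum.cong) (auto simp: c_def)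
      then show ?thesis
        using fin rho(3) by (simp add: c_def)
    qed
    finally show ?thesis by simp
  qed
  have h_in: "h t x \<in> topspace ?X" if x: "x \<in> topspace ?X" and t: "t \<in> {0..1}" for t x
  proof -
    let ?S = "{u. x u \<noteq> 0} \<union> insert v \<rho>"
    have S: "finite ?S" using supp[OF x] fin by simp
    have sx: "sum x ?S = 1" 
      using x in_geometric_realization[OF S, of x K] by auto
    have sub: "{u. h t x u \<noteq> 0} \<subseteq> ?S"
      by (auto simp: h_def c_def split: if_splits)
    have "sum (h t x) ?S = sum x ?S + t * m x * sum c ?S"
      by (simp add: h_def sum.distrib sum_distrib_left)
    then have s: "sum (h t x) ?S = 1"
      using sx sum_c[OF S Un_upper2] by simp
    have "0 \<le> h t x u" for u
    proof (cases "u \<in> \<rho>")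
      case True
      have "t * m x \<le> 1 * m x"
        using t mpos[OF x] by (intro mult_right_mono) auto
      then show ?thesis using mle[OF True, of x] True rho(3) by (auto simp: h_def c_def)
    next
      case False
      then show ?thesis using nonneg[OF x] mpos[OF x] t by (auto simp: h_def c_def)
    qed
    then show ?thesis
      using in_geometric_realization[OF S sub] supp_h[OF x] s by simp
  qed
  have h1: "h 1 x \<in> topspace ?Y" if x: "x \<in> topspace ?X" for x
  proof -
    obtain u where "u \<in> \<rho>" "m x = x u"
      unfolding m_def using fin rho(2) by (rule INF_finite_attained)
    then have "\<not> \<rho> \<subseteq> {u. h 1 x u \<noteq> 0}"
      using rho(3) by (auto simp: h_def c_def)
    then show ?thesis
      using h_in[OF x, of 1] by (auto simp: topspace_geometric_realization)
  qed
  have cm: "continuous_map ?X euclideanreal m"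
    unfolding m_def using fin
    by (intro continuous_map_Inf continuous_map_geometric_realization_coordinate)
  have ch: "continuous_map ?X euclideanreal (\<lambda>x. h 1 x u)" for u
    unfolding h_def
    by (intro continuous_intros continuous_map_geometric_realization_coordinate cm) auto
  have ret: "retraction_maps ?X ?Y (h 1) id"
    unfolding retraction_maps_def
  proof (intro conjI ballI)
    show "continuous_map ?X ?Y (h 1)"
      using ch h1 by (intro continuous_map_into_geometric_realization) auto
    show "continuous_map ?Y ?X id"
      by (intro continuous_map_into_geometric_realization)
        (auto simp: topspace_geometric_realization continuous_map_geometric_realization_coordinate)
    fix x assume "x \<in> topspace ?Y"
    then have "x \<in> topspace ?X" "\<not> \<rho> \<subseteq> {u. x u \<noteq> 0}"
      by (auto simp: topspace_geometric_realization)
    then show "h 1 (id x) = x" by (simp add: h_def m0)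
  qed
  have "homotopic_with (\<lambda>x. True) ?X ?X (h 0) (h 1)"
    unfolding homotopic_with_def
  proof (intro exI[of _ "\<lambda>(t, x). h t x"] conjI allI ballI)
    let ?P = "prod_topology (top_of_set {0..1::real}) ?X"
    have fst: "continuous_map ?P euclideanreal fst"
      using continuous_map_fst continuous_map_into_fulltopology by blast
    have comp: "continuous_map ?P euclideanreal (\<lambda>p. g (snd p))"
      if "continuous_map ?X euclideanreal g" for g
      using continuous_map_compose[OF continuous_map_snd that] by (simp add: o_def)
    have "continuous_map ?P euclideanreal (\<lambda>p. snd p u + fst p * m (snd p) * c u)" for u
      by (intro continuous_intros fst comp[OF cm]
          comp[OF continuous_map_geometric_realization_coordinate]) auto
    then show "continuous_map ?P ?X (\<lambda>(t, x). h t x)"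
      using h_in by (intro continuous_map_into_geometric_realization) (auto simp: h_def case_prod_beta)
  qed auto
  moreover have "h 0 = id" by (auto simp: h_def)
  ultimately have "homotopic_with (\<lambda>x. True) ?X ?X (h 1) id"
    using homotopic_with_symD by metis
  then show ?thesis
    using ret by (rule deformation_retract_imp_homotopy_equivalent_space)
qed

text \<open>Iterates the preceding proposition over the minimal faces in \<open>K - L\<close>.\<close>

proposition homotopy_equivalent_cone_collapse:
  fixes K L :: "'a set set"
  assumes "finite_complex K" "finite_complex L" "L \<subseteq> K" "{} \<in> L"
    and "\<And>F. F \<in> K - L \<Longrightarrow> insert v F \<in> K"
    and "\<And>F. F \<in> K - L \<Longrightarrow> F - {v} \<notin> L"
  shows "geometric_realization K homotopy_equivalent_space geometric_realization L"
  using assms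
proof (induction "card (K - L)" arbitrary: K rule: less_induct)
  case less
  show ?case
  proof (cases "K = L")
    case True
    then show ?thesis by (simp add: homotopy_equivalent_space_refl)
  next
    case False
    then have ne: "K - L \<noteq> {}" using less.prems by blast
    have fin: "finite (K - L)" using less.prems(1) by (auto simp: finite_complex_def)
    obtain \<rho> where rho: "\<rho> \<in> K - L" and min: "\<And>F. F \<in> K - L \<Longrightarrow> F \<subseteq> \<rho> \<Longrightarrow> F = \<rho>"
      using finite_has_minimal[OF fin ne] by auto
    have v: "v \<notin> \<rho>"
    proof
      assume "v \<in> \<rho>"
      moreover have "\<rho> - {v} \<in> K - L"
        using rho less.prems(6) finite_complex_mono[OF less.prems(1), of \<rho> "\<rho> - {v}"] by blast
      ultimately show False using min by blast
    qed
    have rn: "\<rho> \<noteq> {}" using rho less.prems by auto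
    let ?K = "{F \<in> K. \<not> \<rho> \<subseteq> F}"
    have up: "F \<in> K - L" if "F \<in> K" "\<rho> \<subseteq> F" for F
      using that rho finite_complex_mono[OF less.prems(2)] by blast
    have 1: "geometric_realization K homotopy_equivalent_space geometric_realization ?K"
    proof (rule homotopy_equivalent_remove_star[OF less.prems(1) _ rn v])
      show "\<rho> \<in> K" using rho by blast
      show "insert v F \<in> K" if "F \<in> K" "\<rho> \<subseteq> F" for F
        using less.prems(5)[OF up[OF that]] .
    qed
    have 2: "geometric_realization ?K homotopy_equivalent_space geometric_realization L"
    proof (rule less.hyps)
      show "card (?K - L) < card (K - L)"
        using fin rho by (intro psubset_card_mono) auto
      show "finite_complex ?K"
        using less.prems(1) unfolding finite_complex_def by auto
      show "L \<subseteq> ?K" using up less.prems(3) by blast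
      \<comment> \<open>As \<open>v\<close> is not in \<open>\<rho>\<close>, adding \<open>v\<close>
        cannot complete \<open>\<rho>\<close>, so the cone condition survives the removal of the
        star.\<close>
      show "insert v F \<in> ?K" if "F \<in> ?K - L" for F
        using that less.prems(5)[of F] v by auto
      show "F - {v} \<notin> L" if "F \<in> ?K - L" for F
        using that less.prems(6) by auto
    qed (use less.prems in auto)
    show ?thesis using 1 2 by (rule homotopy_eqv_trans)
  qed
qed

text \<open>
  The apex may depend on a label. The faces whose label is maximal are removed first; by
  monotonicity of the labels they form an upper set.
\<close>

proposition homotopy_equivalent_labelled_collapse:
  fixes K L :: "'a set set" and lab :: "'a set \<Rightarrow> 'l :: order"
  assumes "finite_complex K" "finite_complex L" "L \<subseteq> K" "{} \<in> L"
    and "\<And>F G. F \<in> K - L \<Longrightarrow> G \<in> K - L \<Longrightarrow> F \<subseteq> G \<Longrightarrow> lab F \<le> lab G"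
    and "\<And>F. F \<in> K - L \<Longrightarrow> \<exists>v. \<forall>G\<in>K - L. lab G = lab F \<longrightarrow>
      insert v G \<in> K \<and> G - {v} \<notin> L \<and> lab (insert v G) = lab F \<and> lab (G - {v}) = lab F"
  shows "geometric_realization K homotopy_equivalent_space geometric_realization L"
  using assms
proof (induction "card (K - L)" arbitrary: K rule: less_induct)
  case less
  show ?case
  proof (cases "K = L")
    case True
    then show ?thesis by (simp add: homotopy_equivalent_space_refl)
  next
    case False
    then have ne: "K - L \<noteq> {}" using less.prems by blast
    have fin: "finite (K - L)" using less.prems(1) by (auto simp: finite_complex_def)
    obtain F0 where F0: "F0 \<in> K - L" and max: "\<And>F. F \<in> K - L \<Longrightarrow> lab F0 \<le> lab F \<Longrightarrow> lab F = lab F0"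
      using finite_has_maximal[of "lab ` (K - L)"] fin ne by fastforce
    obtain v where v: "\<And>G. G \<in> K - L \<Longrightarrow> lab G = lab F0 \<Longrightarrow>
      insert v G \<in> K \<and> G - {v} \<notin> L \<and> lab (insert v G) = lab F0 \<and> lab (G - {v}) = lab F0"
      using less.prems(6)[OF F0] by blast
    let ?R = "{F \<in> K - L. lab F = lab F0}"
    let ?K = "K - ?R"
    have up: "G \<in> ?R" if "F \<in> ?R" "G \<in> K" "F \<subseteq> G" for F G
      using that max less.prems(5)[of F G] finite_complex_mono[OF less.prems(2)] by fastforce
    have K': "finite_complex ?K"
      unfolding finite_complex_def
    proof (intro conjI ballI allI impI)
      show "finite ?K" using less.prems(1) by (simp add: finite_complex_def)
      show "finite F" if "F \<in> ?K" for F
        using that finite_complex_finite_face[OF less.prems(1)] by blast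
      show "G \<in> ?K" if F: "F \<in> ?K" and G: "G \<subseteq> F" for F G
      proof -
        have "G \<in> K" using finite_complex_mono[OF less.prems(1) _ G] F by blast
        moreover have "G \<notin> ?R" using up[OF _ _ G] F by (meson DiffD1 DiffD2)
        ultimately show ?thesis by (rule DiffI)
      qed
    qed
    have 1: "geometric_realization K homotopy_equivalent_space geometric_realization ?K"
    proof (rule homotopy_equivalent_cone_collapse[OF less.prems(1) K'])
      show "insert v F \<in> K" if "F \<in> K - ?K" for F
        using that v by blast
      show "F - {v} \<notin> ?K" if "F \<in> K - ?K" for F
      proof -
        have "F \<in> K" "F - {v} \<notin> L" "lab (F - {v}) = lab F0"
          using that v by blast+
        then show ?thesis
          using finite_complex_mono[OF less.prems(1), of F "F - {v}"] by blast
      qed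
    qed (use less.prems in auto)
    have 2: "geometric_realization ?K homotopy_equivalent_space geometric_realization L"
    proof (rule less.hyps)
      show "card (?K - L) < card (K - L)"
        using fin F0 by (intro psubset_card_mono) auto
      show "\<exists>v. \<forall>G\<in>?K - L. lab G = lab F \<longrightarrow>
          insert v G \<in> ?K \<and> G - {v} \<notin> L \<and> lab (insert v G) = lab F \<and> lab (G - {v}) = lab F"
        if "F \<in> ?K - L" for F
        using that less.prems(6)[of F] by fastforce
    qed (use less.prems K' in auto)
    show ?thesis using 1 2 by (rule homotopy_eqv_trans)
  qed
qed

subsection \<open>Relabelling and wedges of spheres\<close>

text \<open>Injectivity is asked only on the vertices that occur, since the relabelling applied
  later is degenerate elsewhere; coordinates outside the image of the vertices are set to 0.\<close>

lemma homeomorphic_relabelled_realization: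
  assumes K: "finite_complex K" and inj: "inj_on f (\<Union>K)"
  shows "geometric_realization K homeomorphic_space geometric_realization ((`) f ` K)"
proof -
  define V where "V = \<Union>K"
  have V: "finite V" using K by (auto simp: V_def finite_complex_def)
  have inj: "inj_on f V" using inj by (simp add: V_def)
  define \<phi> where "\<phi> x w = (if w \<in> f ` V then x (inv_into V f w) else 0)" for x :: "'a \<Rightarrow> real" and w
  define \<psi> where "\<psi> y v = (if v \<in> V then y (f v) else 0)" for y :: "'b \<Rightarrow> real" and v
  have phi: "\<phi> x (f v) = x v" if "v \<in> V" for x v
    using that inj by (simp add: \<phi>_def)
  have suppK: "{v. x v \<noteq> 0} \<subseteq> V" if "x \<in> topspace (geometric_realization K)" for x
    using that by (auto simp: topspace_geometric_realization V_def)
  have suppf: "{w. y w \<noteq> 0} \<subseteq> f ` V"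
    if "y \<in> topspace (geometric_realization ((`) f ` K))" for y
  proof -
    have "{w. y w \<noteq> 0} \<in> (`) f ` K"
      using that by (simp add: topspace_geometric_realization)
    then obtain F where "F \<in> K" "{w. y w \<noteq> 0} = f ` F"
      by (rule imageE)
    moreover have "F \<subseteq> V" using \<open>F \<in> K\<close> by (auto simp: V_def)
    ultimately show ?thesis by (simp add: image_mono)
  qed
  have phi_in: "\<phi> x \<in> topspace (geometric_realization ((`) f ` K))"
    if x: "x \<in> topspace (geometric_realization K)" for x
  proof -
    have s: "{w. \<phi> x w \<noteq> 0} = f ` {v. x v \<noteq> 0}"
    proof (intro equalityI subsetI)
      fix w assume "w \<in> {w. \<phi> x w \<noteq> 0}"
      then have "w \<in> f ` V" "x (inv_into V f w) \<noteq> 0"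
        by (auto simp: \<phi>_def split: if_splits)
      then show "w \<in> f ` {v. x v \<noteq> 0}"
        using f_inv_into_f[of w f V] by (intro image_eqI[of _ _ "inv_into V f w"]) auto
    next
      fix w assume "w \<in> f ` {v. x v \<noteq> 0}"
      then show "w \<in> {w. \<phi> x w \<noteq> 0}"
        using suppK[OF x] phi by auto
    qed
    have "sum (\<phi> x) (f ` V) = sum x V"
      using inj by (simp add: sum.reindex phi)
    moreover have "sum x V = 1" "{v. x v \<noteq> 0} \<in> K" "\<And>v. 0 \<le> x v"
      using x in_geometric_realization[OF V suppK[OF x], of K] by auto
    moreover have "{w. \<phi> x w \<noteq> 0} \<subseteq> f ` V"
      using s suppK[OF x] by blast
    ultimately show ?thesis
      using s in_geometric_realization[of "f ` V" "\<phi> x" "(`) f ` K"] V by (auto simp: \<phi>_def)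
  qed
  have psi_in: "\<psi> y \<in> topspace (geometric_realization K)"
    if y: "y \<in> topspace (geometric_realization ((`) f ` K))" for y
  proof -
    have "{w. y w \<noteq> 0} \<in> (`) f ` K"
      using y by (simp add: topspace_geometric_realization)
    then obtain F where F: "F \<in> K" "{w. y w \<noteq> 0} = f ` F"
      by (rule imageE)
    have FV: "F \<subseteq> V" using F(1) by (auto simp: V_def)
    have s: "{v. \<psi> y v \<noteq> 0} = F"
    proof -
      have "v \<in> F" if "v \<in> V" "y (f v) \<noteq> 0" for v
      proof -
        have "f v \<in> f ` F" using that(2) F(2) by blast
        then show ?thesis using inj_on_image_mem_iff[OF inj that(1) FV] by simp
      qed
      moreover have "y (f v) \<noteq> 0" if "v \<in> F" for v
        using that F(2) by auto
      ultimately show ?thesis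
        using FV by (auto simp: \<psi>_def)
    qed
    have "sum (\<psi> y) V = sum y (f ` V)"
      using inj by (simp add: sum.reindex \<psi>_def)
    moreover have "sum y (f ` V) = 1" "\<And>w. 0 \<le> y w"
      using y in_geometric_realization[OF _ suppf[OF y], of "(`) f ` K"] V by auto
    ultimately show ?thesis
      using s F(1) FV in_geometric_realization[OF V, of "\<psi> y" K] by (auto simp: \<psi>_def)
  qed
  have "homeomorphic_maps (geometric_realization K) (geometric_realization ((`) f ` K)) \<phi> \<psi>"
    unfolding homeomorphic_maps_def
  proof (intro conjI ballI)
    show "continuous_map (geometric_realization K) (geometric_realization ((`) f ` K)) \<phi>"
      using phi_in by (intro continuous_map_into_geometric_realization)
        (auto simp: \<phi>_def continuous_map_geometric_realization_coordinate)
    show "continuous_map (geometric_realization ((`) f ` K)) (geometric_realization K) \<psi>"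
      using psi_in by (intro continuous_map_into_geometric_realization)
        (auto simp: \<psi>_def continuous_map_geometric_realization_coordinate)
    show "\<psi> (\<phi> x) = x" if "x \<in> topspace (geometric_realization K)" for x
    proof
      show "\<psi> (\<phi> x) v = x v" for v
        using suppK[OF that] by (cases "v \<in> V") (auto simp: \<psi>_def phi)
    qed
    show "\<phi> (\<psi> y) = y" if "y \<in> topspace (geometric_realization ((`) f ` K))" for y
    proof
      show "\<phi> (\<psi> y) w = y w" for w
        
      proof (cases "w \<in> f ` V")
        case True
        then show ?thesis by (auto simp: \<psi>_def phi)
      next
        case False
        then show ?thesis using suppf[OF that] by (auto simp: \<phi>_def)
      qed
    qed
  qed
  then show ?thesis
    by (rule homeomorphic_maps_imp_homeomorphic_space)
qed

text \<open>
  The sphere is identified with the boundary of the simplex on the nodes \<open>0, \<dots>, d + 1\<close> by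
  shifting the coordinates along the diagonal until their minimum (with \<open>y (d + 1) = 0\<close>) is \<open>0\<close>.
\<close>

definition shifted :: "nat \<Rightarrow> (nat \<Rightarrow> real) \<Rightarrow> nat \<Rightarrow> real" where
  "shifted d y k = y k - (INF j\<in>{..Suc d}. y j)"

definition barycentric :: "nat \<Rightarrow> (nat \<Rightarrow> real) \<Rightarrow> nat \<Rightarrow> real" where
  "barycentric d y k = shifted d y k / (\<Sum>j\<le>Suc d. shifted d y j)"

lemma topspace_nsphere: "topspace (nsphere d) = {y. (\<Sum>i\<le>d. y i ^ 2) = 1 \<and> (\<forall>i>d. y i = 0)}"
  by (simp add: nsphere)

lemma shifted_nonneg: "k \<le> Suc d \<Longrightarrow> 0 \<le> shifted d y k"
  unfolding shifted_def using INF_finite_le[of "{..Suc d}" k y] by simp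

lemma shifted_zero: obtains k where "k \<le> Suc d" "shifted d y k = 0"
proof -
  obtain k where "k \<in> {..Suc d}" "(INF j\<in>{..Suc d}. y j) = y k"
    by (rule INF_finite_attained[of "{..Suc d}" y]) auto
  then show thesis using that[of k] by (simp add: shifted_def)
qed

lemma shifted_sum_pos:
  assumes "y \<in> topspace (nsphere d)"
  shows "0 < (\<Sum>j\<le>Suc d. shifted d y j)"
proof (rule ccontr)
  assume "\<not> ?thesis"
  then have "(\<Sum>j\<le>Suc d. shifted d y j) = 0"
    using sum_nonneg[of "{..Suc d}" "shifted d y"] shifted_nonneg[of _ d y] by (simp add: not_less)
  then have zero: "shifted d y j = 0" if "j \<le> Suc d" for j
    using that shifted_nonneg[of _ d y] by (subst (asm) sum_nonneg_eq_0_iff) auto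
  have "y j = 0" if "j \<le> d" for j
    using zero[of j] zero[of "Suc d"] that assms by (simp add: shifted_def topspace_nsphere)
  then show False
    using assms by (simp add: topspace_nsphere)
qed

lemma barycentric_sum: "y \<in> topspace (nsphere d) \<Longrightarrow> (\<Sum>k\<le>Suc d. barycentric d y k) = 1"
  using shifted_sum_pos[of y d] unfolding barycentric_def sum_divide_distrib[symmetric] by simp

lemma barycentric_nonneg: "y \<in> topspace (nsphere d) \<Longrightarrow> k \<le> Suc d \<Longrightarrow> 0 \<le> barycentric d y k"
  unfolding barycentric_def
  using shifted_sum_pos[of y d] shifted_nonneg[of k d y] by (intro divide_nonneg_pos)

lemma barycentric_zero: obtains k where "k \<le> Suc d" "barycentric d y k = 0"
  using shifted_zero[of d y] by (metis barycentric_def div_0)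

text \<open>Undoes the shift: as coordinate \<open>Suc d\<close> of a point of the sphere is 0,
  differences to the last barycentric coordinate give the point back up to a positive
  factor.\<close>

lemma barycentric_difference:
  assumes "y \<in> topspace (nsphere d)"
  shows "y k = (\<Sum>j\<le>Suc d. shifted d y j) * (barycentric d y k - barycentric d y (Suc d))"
  using assms shifted_sum_pos[OF assms]
  unfolding barycentric_def diff_divide_distrib[symmetric]
  by (simp add: shifted_def topspace_nsphere)

text \<open>Both points are positive multiples of the same vector of differences, and both have
  length 1.\<close>

lemma barycentric_inj:
  assumes y: "y \<in> topspace (nsphere d)" and y': "y' \<in> topspace (nsphere d)"
    and eq: "\<And>k. k \<le> Suc d \<Longrightarrow> barycentric d y k = barycentric d y' k"
  shows "y = y'"
proof -
  define s s' where "s = (\<Sum>j\<le>Suc d. shifted d y j)" and "s' = (\<Sum>j\<le>Suc d. shifted d y' j)"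
  define b where "b k = barycentric d y k - barycentric d y (Suc d)" for k
  have pos: "0 < s" "0 < s'"
    unfolding s_def s'_def by (rule shifted_sum_pos; fact)+
  have yk: "y k = s * b k" "y' k = s' * b k" if "k \<le> d" for k
    using barycentric_difference[OF y, of k] barycentric_difference[OF y', of k] that
    by (simp_all add: s_def s'_def b_def eq)
  have "s\<^sup>2 * (\<Sum>k\<le>d. (b k)\<^sup>2) = 1" "s'\<^sup>2 * (\<Sum>k\<le>d. (b k)\<^sup>2) = 1"
    using y y' by (simp_all add: topspace_nsphere yk power_mult_distrib sum_distrib_left)
  then have "s\<^sup>2 = s'\<^sup>2"
    by (metis mult_cancel_right mult_zero_right zero_neq_one)
  then have "s = s'" using pos by (simp add: power2_eq_iff_nonneg)
  then have "y k = y' k" for k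
    using yk[of k] y y' by (cases "k \<le> d") (auto simp: topspace_nsphere)
  then show ?thesis by blast
qed

text \<open>The inverse moves \<open>b\<close> along the diagonal until its last coordinate is 0 and
  normalises the length. The vanishing coordinate \<open>k0\<close> shows that the length is not 0,
  and it is where the minimum of \<open>y\<close> is attained, so that the shift restores
  \<open>b\<close> up to the factor \<open>1 / r\<close>.\<close>

lemma barycentric_surj:
  assumes nonneg: "\<And>k. k \<le> Suc d \<Longrightarrow> 0 \<le> b k" and sum: "(\<Sum>k\<le>Suc d. b k) = 1"
    and zero: "k0 \<le> Suc d" "b k0 = 0"
  obtains y where "y \<in> topspace (nsphere d)" "\<And>k. k \<le> Suc d \<Longrightarrow> barycentric d y k = b k"
proof -
  define r where "r = sqrt (\<Sum>k\<le>d. (b k - b (Suc d))\<^sup>2)"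
  have "(\<Sum>k\<le>d. (b k - b (Suc d))\<^sup>2) \<noteq> 0"
  proof
    assume "(\<Sum>k\<le>d. (b k - b (Suc d))\<^sup>2) = 0"
    then have "b k = b (Suc d)" if "k \<le> Suc d" for k
      using that by (subst (asm) sum_nonneg_eq_0_iff) (auto simp: le_Suc_eq)
    then have "b k = 0" if "k \<le> Suc d" for k
      using that zero by metis
    then show False using sum by simp
  qed
  moreover have "0 \<le> (\<Sum>k\<le>d. (b k - b (Suc d))\<^sup>2)"
    by (intro sum_nonneg) simp
  ultimately have r: "0 < r" "r\<^sup>2 = (\<Sum>k\<le>d. (b k - b (Suc d))\<^sup>2)"
    by (auto simp: r_def)
  define y where "y k = (if k \<le> Suc d then (b k - b (Suc d)) / r else 0)" for k
  have y: "y \<in> topspace (nsphere d)"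
  proof -
    have "(\<Sum>i\<le>d. (y i)\<^sup>2) = (\<Sum>k\<le>d. (b k - b (Suc d))\<^sup>2) / r\<^sup>2"
      by (simp add: y_def power_divide sum_divide_distrib)
    moreover have "y i = 0" if "i > d" for i
      using that by (auto simp: y_def le_Suc_eq)
    ultimately show ?thesis
      using r(1) unfolding r(2)[symmetric] by (simp add: topspace_nsphere)
  qed
  have "(INF j\<in>{..Suc d}. y j) = - b (Suc d) / r"
  proof (rule antisym)
    show "(INF j\<in>{..Suc d}. y j) \<le> - b (Suc d) / r"
      using INF_finite_le[of "{..Suc d}" k0 y] zero by (simp add: y_def)
    show "- b (Suc d) / r \<le> (INF j\<in>{..Suc d}. y j)"
      using nonneg r by (intro cINF_greatest) (auto simp: y_def field_simps)
  qed
  then have sh: "shifted d y k = b k / r" if "k \<le> Suc d" for k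
    using that by (simp add: shifted_def y_def diff_divide_distrib)
  then have "(\<Sum>j\<le>Suc d. shifted d y j) = (\<Sum>j\<le>Suc d. b j) / r"
    unfolding sum_divide_distrib by (intro sum.cong) auto
  then have "(\<Sum>j\<le>Suc d. shifted d y j) = 1 / r"
    using sum by simp
  then have "barycentric d y k = b k" if "k \<le> Suc d" for k
    using sh[OF that] r by (simp add: barycentric_def)
  then show thesis using that y by blast
qed

lemma barycentric_pole: "k \<le> Suc d \<Longrightarrow> barycentric d pole k = pole k"
proof -
  have "(INF j\<in>{..Suc d}. pole j) = 0"
  proof (rule antisym)
    show "(INF j\<in>{..Suc d}. pole j) \<le> 0"
      using INF_finite_le[of "{..Suc d}" "Suc d" pole] by (simp add: pole_def)
    show "0 \<le> (INF j\<in>{..Suc d}. pole j)"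
      by (intro cINF_greatest) (auto simp: pole_def)
  qed
  then show ?thesis
    by (simp add: barycentric_def shifted_def) (simp add: pole_def if_distrib sum.delta)
qed

lemma continuous_map_barycentric:
  assumes "k \<le> Suc d"
  shows "continuous_map (nsphere d) euclideanreal (\<lambda>y. barycentric d y k)"
proof -
  have "continuous_map (nsphere d) euclideanreal (\<lambda>y. shifted d y k)" for k
    unfolding shifted_def
    by (intro continuous_intros continuous_map_nsphere_projection) auto
  then show ?thesis
    unfolding barycentric_def using shifted_sum_pos
    by (intro continuous_map_real_divide continuous_map_sum) (auto simp del: sum.atMost_Suc, force)
qed

text \<open>By Tychonoff, as a closed subset of a product of copies of the interval from -1 to 1 and
  of the point 0. Compactness later turns a continuous bijection from the wedge into a
  homeomorphism.\<close>

lemma compact_space_nsphere: "compact_space (nsphere d)"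
proof -
  let ?B = "product_topology (\<lambda>i. top_of_set (if i \<le> d then {-1..1} else {0 :: real})) (UNIV :: nat set)"
  let ?S = "{x :: nat \<Rightarrow> real. (\<Sum>i\<le>d. x i ^ 2) = 1}"
  have c: "compact_space (top_of_set (if i \<le> d then {-1..1} else {0 :: real}))" for i
    by (simp add: compact_space_subtopology)
  have B: "compact_space ?B"
    unfolding compact_space_product_topology by (intro disjI2 ballI c)
  have eq: "?B = subtopology (powertop_real UNIV) (\<Pi>\<^sub>E i\<in>UNIV. if i \<le> d then {-1..1} else {0})"
    by (simp add: subtopology_product_topology)
  have "continuous_map ?B euclideanreal (\<lambda>x. \<Sum>i\<le>d. x i ^ 2)"
    unfolding eq
    by (intro continuous_intros) auto
  then have "closedin ?B {x \<in> topspace ?B. (\<Sum>i\<le>d. x i ^ 2) \<in> {1}}"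
    by (rule closedin_continuous_map_preimage) simp
  then have comp: "compact_space (subtopology ?B {x \<in> topspace ?B. (\<Sum>i\<le>d. x i ^ 2) \<in> {1}})"
    using B closedin_compact_space compact_space_subtopology by blast
  have "x i \<in> {-1..1}" if "(\<Sum>i\<le>d. x i ^ 2) = 1" "i \<le> d" for x :: "nat \<Rightarrow> real" and i
  proof -
    have "(x i)\<^sup>2 \<le> (\<Sum>i\<le>d. x i ^ 2)"
      using that by (intro member_le_sum) auto
    then have "\<bar>x i\<bar> \<le> 1" using that by (simp add: abs_square_le_1)
    then show ?thesis by auto
  qed
  then have "(\<Pi>\<^sub>E i\<in>UNIV. if i \<le> d then {-1..1} else {0}) \<inter>
      {x \<in> topspace ?B. (\<Sum>i\<le>d. x i ^ 2) \<in> {1}} =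
      {x. (\<Sum>i\<le>d. x i ^ 2) = 1 \<and> (\<forall>i>d. x i = 0)}"
    by (auto simp: PiE_iff split: if_splits)
  then have "subtopology ?B {x \<in> topspace ?B. (\<Sum>i\<le>d. x i ^ 2) \<in> {1}} = nsphere d"
    by (simp only: eq nsphere subtopology_subtopology)
  then show ?thesis
    using comp by (simp only:)
qed

text \<open>The map \<open>g\<close> places sphere \<open>i\<close> on the boundary of simplex
  \<open>i\<close>. Since distinct simplices share only the node \<open>z\<close>, which is the
  image of every base point, \<open>g\<close> has the same fibres as the quotient map
  \<open>q\<close>; the induced bijection goes from a compact space to a Hausdorff space.\<close>

proposition wedge_of_spheres_homeomorphic_realization:
  fixes lam :: "nat \<Rightarrow> nat \<Rightarrow> 'v"
  assumes base: "\<And>i. i < length ds \<Longrightarrow> lam i 0 = z"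
    and inj: "\<And>i k i' k'. \<lbrakk>i < length ds; i' < length ds; k \<le> Suc (ds ! i); k' \<le> Suc (ds ! i');
      lam i k = lam i' k'\<rbrakk> \<Longrightarrow> (i = i' \<or> k = 0) \<and> k = k'"
  shows "wedge_of_spheres ds homeomorphic_space
    geometric_realization {F. \<exists>i<length ds. F \<subset> lam i ` {..Suc (ds ! i)}}"
proof -
  let ?K = "{F. \<exists>i<length ds. F \<subset> lam i ` {..Suc (ds ! i)}}"
  let ?S = "sum_topology (\<lambda>i. nsphere (ds ! i)) {..<length ds}"
  define q where "q = (\<lambda>(i::nat, y). if y = pole then None else Some (i, y))"
  define g where "g = (\<lambda>(i, y) u. \<Sum>k\<le>Suc (ds ! i). if lam i k = u then barycentric (ds ! i) y k else 0)"
  have inj_i: "inj_on (lam i) {..Suc (ds ! i)}" if "i < length ds" for i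
    using inj[OF that that] by (auto simp: inj_on_def)
  have g_lam: "g (i, y) (lam i k) = barycentric (ds ! i) y k"
    if i: "i < length ds" and "k \<le> Suc (ds ! i)" for i k y
  proof -
    have "g (i, y) (lam i k) = (\<Sum>j\<le>Suc (ds ! i). if j = k then barycentric (ds ! i) y j else 0)"
      unfolding g_def prod.case
      using that inj[OF i i, of _ k] by (intro sum.cong) auto
    then show ?thesis using that by (simp del: sum.atMost_Suc)
  qed
  have g_out: "g (i, y) u = 0" if "u \<notin> lam i ` {..Suc (ds ! i)}" for i y u
    unfolding g_def prod.case using that by (intro sum.neutral) auto
  have g_in: "g (i, y) \<in> topspace (geometric_realization ?K)"
    if i: "i < length ds" and y: "y \<in> topspace (nsphere (ds ! i))" for i y
  proof -
    let ?L = "lam i ` {..Suc (ds ! i)}"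
    have s: "{u. g (i, y) u \<noteq> 0} \<subseteq> ?L" using g_out by blast
    obtain k where "k \<le> Suc (ds ! i)" "barycentric (ds ! i) y k = 0"
      using barycentric_zero[of "ds ! i" y] by blast
    then have "lam i k \<in> ?L" "lam i k \<notin> {u. g (i, y) u \<noteq> 0}"
      using g_lam[OF i] by auto
    then have "{u. g (i, y) u \<noteq> 0} \<in> ?K" using s i by blast
    moreover have "sum (g (i, y)) ?L = 1"
      using inj_i[OF i] g_lam[OF i] barycentric_sum[OF y]
      by (simp add: sum.reindex del: sum.atMost_Suc)
    moreover have "0 \<le> g (i, y) u" for u
      using g_out[of u i y] g_lam[OF i] barycentric_nonneg[OF y] by (cases "u \<in> ?L") auto
    ultimately show ?thesis
      using in_geometric_realization[of ?L "g (i, y)"] s by simp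
  qed
  have "continuous_map (nsphere (ds ! i)) euclideanreal (\<lambda>y. g (i, y) u)" for i u
    unfolding g_def prod.case
    by (intro continuous_map_sum) (auto simp: continuous_map_barycentric)
  then have cont_i: "continuous_map (nsphere (ds ! i)) (geometric_realization ?K) (\<lambda>y. g (i, y))"
    if "i < length ds" for i
    using that g_in by (intro continuous_map_into_geometric_realization) auto
  have cont: "continuous_map ?S (geometric_realization ?K) g"
    unfolding continuous_map_def
  proof (intro conjI allI impI)
    show "g \<in> topspace ?S \<rightarrow> topspace (geometric_realization ?K)"
      using g_in by auto
    fix U assume U: "openin (geometric_realization ?K) U"
    have "openin (nsphere (ds ! i)) {y \<in> topspace (nsphere (ds ! i)). g (i, y) \<in> U}"
      if "i < length ds" for i
      using openin_continuous_map_preimage[OF cont_i[OF that] U] .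
    then show "openin ?S {x \<in> topspace ?S. g x \<in> U}"
      by (auto simp: openin_sum_topology)
  qed
  have pole: "g (i, pole) = (\<lambda>u. if u = z then 1 else 0)" if i: "i < length ds" for i
  proof
    fix u
    show "g (i, pole) u = (if u = z then 1 else 0)"
    proof (cases "u \<in> lam i ` {..Suc (ds ! i)}")
      case True
      then obtain k where k: "k \<le> Suc (ds ! i)" "u = lam i k" by auto
      then have "u = z \<longleftrightarrow> k = 0"
        using base[OF i] inj[OF i i, of k 0] by auto
      then show ?thesis
        using g_lam[OF i k(1)] k barycentric_pole[OF k(1)] by (simp add: pole_def)
    next
      case False
      then have "u \<noteq> z" using base[OF i] by force
      then show ?thesis using g_out[OF False] by simp
    qed
  qed
  have pole_if: "y = pole"
    if i: "i < length ds" and y: "y \<in> topspace (nsphere (ds ! i))"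
      and *: "\<And>k. 0 < k \<Longrightarrow> k \<le> Suc (ds ! i) \<Longrightarrow> barycentric (ds ! i) y k = 0" for i y
  proof (rule barycentric_inj[OF y pole_in_nsphere])
    have "barycentric (ds ! i) y 0 = 1"
      using barycentric_sum[OF y] * by (simp add: sum.atMost_shift del: sum.atMost_Suc)
    then show "barycentric (ds ! i) y k = barycentric (ds ! i) pole k" if "k \<le> Suc (ds ! i)" for k
      using * that barycentric_pole[OF that] by (cases k) (auto simp: pole_def)
  qed
  have fibres: "g p = g p' \<longleftrightarrow> q p = q p'" if p: "p \<in> topspace ?S" and p': "p' \<in> topspace ?S" for p p'
  proof -
    obtain i y i' y' where [simp]: "p = (i, y)" "p' = (i', y')" by (metis surj_pair)
    have i: "i < length ds" "y \<in> topspace (nsphere (ds ! i))"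
      and i': "i' < length ds" "y' \<in> topspace (nsphere (ds ! i'))"
      using p p' by auto
    show ?thesis
    proof
      assume eq: "g p = g p'"
      show "q p = q p'"
      proof (cases "i = i'")
        case True
        have "y = y'"
          using i(2)
        proof (rule barycentric_inj)
          show "y' \<in> topspace (nsphere (ds ! i))" using i'(2) True by simp
          show "barycentric (ds ! i) y k = barycentric (ds ! i) y' k" if "k \<le> Suc (ds ! i)" for k
            using g_lam[OF i(1) that] eq True by (metis \<open>p = (i, y)\<close> \<open>p' = (i', y')\<close>)
        qed
        then show ?thesis using True by simp
      next
        case False
        \<comment> \<open>The common image is supported on both simplices, hence only on
          \<open>z\<close>.\<close>
        have "y = pole" using i
        proof (rule pole_if)
          fix k assume k: "0 < k" "k \<le> Suc (ds ! i)"
          have "lam i k \<notin> lam i' ` {..Suc (ds ! i')}"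
            using inj[OF i(1) i'(1) k(2)] False k by auto
          then show "barycentric (ds ! i) y k = 0"
            using g_lam[OF i(1) k(2), of y] eq g_out by simp
        qed
        moreover have "y' = pole" using i'
        proof (rule pole_if)
          fix k assume k: "0 < k" "k \<le> Suc (ds ! i')"
          have "lam i' k \<notin> lam i ` {..Suc (ds ! i)}"
            using inj[OF i'(1) i(1) k(2)] False k by auto
          then show "barycentric (ds ! i') y' k = 0"
            using g_lam[OF i'(1) k(2), of y'] eq g_out by (metis \<open>p = (i, y)\<close> \<open>p' = (i', y')\<close>)
        qed
        ultimately show ?thesis by (simp add: q_def)
      qed
    next
      assume "q p = q p'"
      then show "g p = g p'"
        using pole[OF i(1)] pole[OF i'(1)] by (auto simp: q_def split: if_splits)
    qed
  qed
  have surj: "g ` topspace ?S = topspace (geometric_realization ?K)"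
  proof
    show "g ` topspace ?S \<subseteq> topspace (geometric_realization ?K)" using g_in by auto
    show "topspace (geometric_realization ?K) \<subseteq> g ` topspace ?S"
    proof
      fix x assume x: "x \<in> topspace (geometric_realization ?K)"
      then obtain i where i: "i < length ds" "{u. x u \<noteq> 0} \<subset> lam i ` {..Suc (ds ! i)}"
        by (auto simp: topspace_geometric_realization)
      let ?L = "lam i ` {..Suc (ds ! i)}"
      have nonneg: "0 \<le> x u" for u
        using x by (simp add: topspace_geometric_realization)
      have "sum x ?L = 1"
        using x in_geometric_realization[of ?L x] i(2) by blast
      then have sum: "(\<Sum>k\<le>Suc (ds ! i). x (lam i k)) = 1"
        using inj_i[OF i(1)] by (simp add: sum.reindex del: sum.atMost_Suc)
      obtain k0 where "k0 \<le> Suc (ds ! i)" "x (lam i k0) = 0"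
        using i(2) by auto
      then obtain y where y: "y \<in> topspace (nsphere (ds ! i))"
        "\<And>k. k \<le> Suc (ds ! i) \<Longrightarrow> barycentric (ds ! i) y k = x (lam i k)"
        using barycentric_surj[of "ds ! i" "\<lambda>k. x (lam i k)" k0] nonneg sum by blast
      have "g (i, y) u = x u" for u
        using g_lam[OF i(1)] y(2) g_out[of u i y] i(2) by (cases "u \<in> ?L") auto
      then have "x = g (i, y)" by auto
      then show "x \<in> g ` topspace ?S" using i(1) y(1) by auto
    qed
  qed
  have qm: "quotient_map ?S (wedge_of_spheres ds) q"
  proof -
    have "wedge_of_spheres ds = quotient_topology ?S q"
      by (simp add: wedge_of_spheres_def wedge_sum_def q_def)
    then show ?thesis by (simp only: quotient_map_quotient_topology)
  qed
  have gq: "g p = g p'" if "p \<in> topspace ?S" "p' \<in> topspace ?S" "q p = q p'" for p p'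
    using fibres that by blast
  obtain h where h: "continuous_map (wedge_of_spheres ds) (geometric_realization ?K) h"
    "h ` topspace (wedge_of_spheres ds) = g ` topspace ?S"
    "\<And>p. p \<in> topspace ?S \<Longrightarrow> h (q p) = g p"
    by (rule quotient_map_lift_exists[OF qm cont]) (use gq in blast)+
  have "compactin (wedge_of_spheres ds) ((q \<circ> Pair i) ` topspace (nsphere (ds ! i)))"
    if "i < length ds" for i
  proof (rule image_compactin)
    show "compactin (nsphere (ds ! i)) (topspace (nsphere (ds ! i)))"
      using compact_space_nsphere by (simp only: compact_space_def)
    have "continuous_map (nsphere (ds ! i)) ?S (Pair i)"
      using that continuous_map_component_injection[of i "{..<length ds}"] by simp
    then show "continuous_map (nsphere (ds ! i)) (wedge_of_spheres ds) (q \<circ> Pair i)"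
      using quotient_imp_continuous_map[OF qm] by (rule continuous_map_compose)
  qed
  then have "compactin (wedge_of_spheres ds)
      (\<Union>((\<lambda>i. (q \<circ> Pair i) ` topspace (nsphere (ds ! i))) ` {..<length ds}))"
    by (intro compactin_Union) auto
  moreover have "topspace (wedge_of_spheres ds) =
      \<Union>((\<lambda>i. (q \<circ> Pair i) ` topspace (nsphere (ds ! i))) ` {..<length ds})"
    unfolding quotient_imp_surjective_map[OF qm, symmetric] by (auto simp: o_def)
  ultimately have comp: "compact_space (wedge_of_spheres ds)"
    by (simp only: compact_space_def)
  have "inj_on h (topspace (wedge_of_spheres ds))"
  proof (rule inj_onI)
    fix w w' assume "w \<in> topspace (wedge_of_spheres ds)" "w' \<in> topspace (wedge_of_spheres ds)"
      and eq: "h w = h w'"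
    then obtain p p' where p: "p \<in> topspace ?S" "p' \<in> topspace ?S" "w = q p" "w' = q p'"
      unfolding quotient_imp_surjective_map[OF qm, symmetric] by blast
    then have "g p = g p'" using eq h(3) by metis
    then show "w = w'" using fibres p by metis
  qed
  then have "homeomorphic_map (wedge_of_spheres ds) (geometric_realization ?K) h"
    using h(2) surj
    by (intro continuous_imp_homeomorphic_map h(1) comp Hausdorff_geometric_realization) simp_all
  then show ?thesis
    by (rule homeomorphic_map_imp_homeomorphic_space)
qed

subsection \<open>Complexes with even and odd nodes\<close>

text \<open>One type carries the nodes of all intermediate complexes, so that these are compared by
  plain inclusion. \<open>Mid k\<close> obeys the same arc conditions as
  \<open>Odd k\<close>.\<close>

datatype node = Even nat | Odd nat | Mid nat | Top | Bot

definition evens :: "node set \<Rightarrow> nat set" where "evens F = {i. Even i \<in> F}"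
definition odds :: "node set \<Rightarrow> nat set" where "odds F = {i. Odd i \<in> F}"
definition mids :: "node set \<Rightarrow> nat set" where "mids F = {i. Mid i \<in> F}"

lemma evens_simps [simp]:
  "evens {} = {}"
  "evens (insert (Even k) F) = insert k (evens F)" "evens (insert (Odd k) F) = evens F"
  "evens (insert (Mid k) F) = evens F" "evens (insert Top F) = evens F" "evens (insert Bot F) = evens F"
  "evens (F - {Even k}) = evens F - {k}" "evens (F - {Odd k}) = evens F"
  "evens (F - {Mid k}) = evens F" "evens (F - {Top}) = evens F" "evens (F - {Bot}) = evens F"
  by (auto simp: evens_def)

lemma odds_simps [simp]:
  "odds {} = {}"
  "odds (insert (Odd k) F) = insert k (odds F)" "odds (insert (Even k) F) = odds F"
  "odds (insert (Mid k) F) = odds F" "odds (insert Top F) = odds F" "odds (insert Bot F) = odds F"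
  "odds (F - {Odd k}) = odds F - {k}" "odds (F - {Even k}) = odds F"
  "odds (F - {Mid k}) = odds F" "odds (F - {Top}) = odds F" "odds (F - {Bot}) = odds F"
  by (auto simp: odds_def)

lemma mids_simps [simp]:
  "mids {} = {}"
  "mids (insert (Mid k) F) = insert k (mids F)" "mids (insert (Even k) F) = mids F"
  "mids (insert (Odd k) F) = mids F" "mids (insert Top F) = mids F" "mids (insert Bot F) = mids F"
  "mids (F - {Mid k}) = mids F - {k}" "mids (F - {Even k}) = mids F"
  "mids (F - {Odd k}) = mids F" "mids (F - {Top}) = mids F" "mids (F - {Bot}) = mids F"
  by (auto simp: mids_def)

lemma evens_mono: "F \<subseteq> G \<Longrightarrow> evens F \<subseteq> evens G"
  by (auto simp: evens_def)

lemma odds_mono: "F \<subseteq> G \<Longrightarrow> odds F \<subseteq> odds G"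
  by (auto simp: odds_def)

lemma mids_mono: "F \<subseteq> G \<Longrightarrow> mids F \<subseteq> mids G"
  by (auto simp: mids_def)

lemma finite_node_complexI:
  assumes nodes: "\<And>F. F \<in> K \<Longrightarrow> evens F \<subseteq> {..<n} \<and> odds F \<subseteq> {..<n} \<and> mids F \<subseteq> {..<n}"
    and down: "\<And>F G. F \<in> K \<Longrightarrow> G \<subseteq> F \<Longrightarrow> G \<in> K"
  shows "finite_complex K"
proof -
  let ?V = "Even ` {..<n} \<union> Odd ` {..<n} \<union> Mid ` {..<n} \<union> {Top, Bot}"
  have V: "F \<subseteq> ?V" if "F \<in> K" for F
  proof
    show "v \<in> ?V" if "v \<in> F" for v
      using that nodes[OF \<open>F \<in> K\<close>] by (cases v) (auto simp: evens_def odds_def mids_def)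
  qed
  have "finite ?V" by simp
  moreover have "K \<subseteq> Pow ?V" using V by blast
  ultimately have "finite K" by (meson finite_Pow_iff finite_subset)
  then show ?thesis
    using V down \<open>finite ?V\<close> unfolding finite_complex_def by (meson finite_subset)
qed

section \<open>Arcs on the circle of indices\<close>

locale cycle_size =
  fixes n :: nat
  assumes n_ge_4: "4 \<le> n"
begin

text \<open>The distance from \<open>j\<close> forward to \<open>k\<close> around the circle, for
  indices below \<open>n\<close>; written by cases, it keeps the goals within linear
  arithmetic.\<close>

definition shift :: "nat \<Rightarrow> nat \<Rightarrow> nat" where
  "shift j k = (if j \<le> k then k - j else k + n - j)"

definition succ :: "nat \<Rightarrow> nat" where
  "succ j = (if Suc j = n then 0 else Suc j)"

definition arc :: "nat \<Rightarrow> nat \<Rightarrow> nat set" where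
  "arc j m = {k. k < n \<and> shift j k \<le> m}"

text \<open>The offset 2 is due to \<open>Odd k\<close> being adjacent to both \<open>Even k\<close>
  and \<open>Even (succ k)\<close>: odd nodes at distances \<open>0\<close> to \<open>m\<close> from
  \<open>j\<close> exclude the even nodes at distances \<open>0\<close> to
  \<open>m + 1\<close>.\<close>

definition coarc :: "nat \<Rightarrow> nat \<Rightarrow> nat set" where
  "coarc j m = {k. k < n \<and> m + 2 \<le> shift j k}"

lemma arc_subset: "arc j m \<subseteq> {..<n}"
  by (auto simp: arc_def)

lemma coarc_subset: "coarc j m \<subseteq> {..<n}"
  by (auto simp: coarc_def)

definition two_coloured :: "nat \<Rightarrow> nat \<Rightarrow> node set \<Rightarrow> bool" where
  "two_coloured j m F \<longleftrightarrow> odds F \<subseteq> arc j m \<and> evens F \<subseteq> coarc j m"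

lemma succ_less: "j < n \<Longrightarrow> succ j < n"
  by (auto simp: succ_def)

lemma succ_in_arc: "j < n \<Longrightarrow> 1 \<le> m \<Longrightarrow> succ j \<in> arc j m"
  by (auto simp: succ_def arc_def shift_def)

lemma arc_psubset: "m + 2 \<le> n \<Longrightarrow> j < n \<Longrightarrow> arc j m \<subset> {..<n}"
proof -
  assume "m + 2 \<le> n" "j < n"
  \<comment> \<open>The predecessor of \<open>j\<close> has distance \<open>n - 1\<close> from
    \<open>j\<close>.\<close>
  then have "(if j = 0 then n - 1 else j - 1) \<in> {..<n} - arc j m"
    by (auto simp: arc_def shift_def)
  then show ?thesis using arc_subset by blast
qed

text \<open>A face that avoids an end of its arc fits into a shorter arc, whose coarc is larger. So
  a face that becomes possible only with a longer arc contains both ends of it.\<close>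

lemma two_coloured_drop_first:
  assumes "j < n" "Suc m < n" "two_coloured j (Suc m) F" "j \<notin> odds F"
  shows "two_coloured (succ j) m F"
proof -
  have shift_succ: "shift (succ j) k = shift j k - 1" if "k < n" "k \<noteq> j" for k
    using that assms(1) by (auto simp: shift_def succ_def)
  have "shift j j = 0" by (simp add: shift_def)
  then have "odds F \<subseteq> arc (succ j) m" "evens F \<subseteq> coarc (succ j) m"
    using assms(3,4) shift_succ by (fastforce simp: two_coloured_def arc_def coarc_def)+
  then show ?thesis
    unfolding two_coloured_def by blast
qed

lemma two_coloured_drop_last:
  assumes "j < n" "two_coloured j (Suc m) F" "\<And>k. k \<in> odds F \<Longrightarrow> shift j k \<noteq> Suc m"
  shows "two_coloured j m F"
proof -
  have "odds F \<subseteq> arc j m"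
    using assms(2,3) unfolding two_coloured_def arc_def by fastforce
  moreover have "coarc j (Suc m) \<subseteq> coarc j m"
    by (auto simp: coarc_def)
  ultimately show ?thesis
    using assms(2) unfolding two_coloured_def by blast
qed

text \<open>The index \<open>e\<close> lies in the gap from \<open>k\<close> forward to
  \<open>j\<close>, so an arc that contains \<open>j\<close> and \<open>k\<close> but stays clear of
  \<open>e\<close> has to run from \<open>j\<close> to \<open>k\<close> and passes
  \<open>succ j\<close>. Hence deleting the apex \<open>Odd (succ j)\<close> never turns a new face
  into an old one.\<close>

lemma succ_in_arc_between:
  assumes "j < n" "1 \<le> m" "k < n" "shift j k = m" "e \<in> coarc j m" "j' < n"
    and "j \<in> arc j' m'" "k \<in> arc j' m'" "e \<in> coarc j' m'"
  shows "succ j \<in> arc j' m'"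
proof -
  have add: "shift j' l = (if shift j' j + shift j l < n then shift j' j + shift j l
      else shift j' j + shift j l - n)" if "l < n" for l
    using that assms(1,6) by (auto simp: shift_def)
  have "shift j (succ j) = 1"
    using assms(1) n_ge_4 by (auto simp: shift_def succ_def)
  moreover have "shift j e < n" "m + 2 \<le> shift j e" "m' + 2 \<le> shift j' e" "e < n"
    using assms(1,5,9) by (auto simp: coarc_def shift_def)
  moreover have "shift j' j \<le> m'" "shift j' k \<le> m'"
    using assms(7,8) by (auto simp: arc_def)
  ultimately have "shift j' (succ j) \<le> m'"
    using add[of k] add[of e] add[of "succ j"] assms(2-4) succ_less[OF assms(1)]
    by (auto split: if_splits)
  then show ?thesis
    using succ_less[OF assms(1)] by (simp add: arc_def)
qed

text \<open>
  \<open>Even i\<close> and \<open>Odd i\<close> are the edges \<open>2 * i\<close> and \<open>2 * i + 1\<close> of the Hasse diagram, a cycle of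
  length \<open>2 * n\<close>. The facets with nodes of both kinds are indexed by the arcs.
\<close>

definition arc_complex :: "(nat \<times> nat) set \<Rightarrow> node set set" where
  "arc_complex T = {F. mids F = {} \<and> Top \<notin> F \<and> Bot \<notin> F \<and>
     (odds F = {} \<and> evens F \<subset> {..<n} \<or> evens F = {} \<and> odds F \<subset> {..<n} \<or>
      (\<exists>(j, m)\<in>T. two_coloured j m F))}"

lemma two_coloured_mono: "two_coloured j m F \<Longrightarrow> G \<subseteq> F \<Longrightarrow> two_coloured j m G"
  unfolding two_coloured_def using evens_mono odds_mono by blast

lemma finite_arc_complex: "finite_complex (arc_complex T)"
proof (rule finite_node_complexI)
  show "evens F \<subseteq> {..<n} \<and> odds F \<subseteq> {..<n} \<and> mids F \<subseteq> {..<n}" if "F \<in> arc_complex T" for F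
    using that arc_subset coarc_subset
    unfolding arc_complex_def two_coloured_def by blast
  show "G \<in> arc_complex T" if "F \<in> arc_complex T" "G \<subseteq> F" for F G
    using that(1) two_coloured_mono[OF _ that(2)] evens_mono[OF that(2)] odds_mono[OF that(2)]
      mids_mono[OF that(2)] that(2)
    unfolding arc_complex_def by blast
qed

lemma arc_complex_empty: "{} \<in> arc_complex T"
proof -
  have "0 \<in> {..<n}" using n_ge_4 by simp
  then have "{} \<subset> {..<n}" by blast
  then show ?thesis by (simp add: arc_complex_def)
qed

text \<open>
  The facet of a longest arc is collapsed onto the shorter ones: its faces that contain both
  ends of the arc and some even node form a cone over the second node of the arc.
\<close>

lemma arc_complex_remove_arc:
  assumes M: "1 \<le> M" "Suc M + 3 \<le> n" and j: "j < n" and J: "J \<subseteq> {..<n}"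
  shows "geometric_realization (arc_complex ({..<n} \<times> {..M} \<union> insert j J \<times> {Suc M}))
    homotopy_equivalent_space geometric_realization (arc_complex ({..<n} \<times> {..M} \<union> J \<times> {Suc M}))"
    (is "geometric_realization ?K homotopy_equivalent_space geometric_realization ?L")
proof (rule homotopy_equivalent_cone_collapse[where v = "Odd (succ j)"])
  show "?L \<subseteq> ?K" unfolding arc_complex_def by blast
  have new: "two_coloured j (Suc M) F" if "F \<in> ?K - ?L" for F
    using that unfolding arc_complex_def by blast
  show "insert (Odd (succ j)) F \<in> ?K" if "F \<in> ?K - ?L" for F
  proof -
    have "two_coloured j (Suc M) (insert (Odd (succ j)) F)"
      using new[OF that] succ_in_arc[of j "Suc M"] j M by (simp add: two_coloured_def)
    then show ?thesis
      using that unfolding arc_complex_def by auto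
  qed
  show "F - {Odd (succ j)} \<notin> ?L" if F: "F \<in> ?K - ?L" for F
  proof
    assume G: "F - {Odd (succ j)} \<in> ?L"
    have notL: "\<not> two_coloured j' m' F" if "(j', m') \<in> {..<n} \<times> {..M} \<union> J \<times> {Suc M}" for j' m'
      using that F unfolding arc_complex_def by blast
    have "j \<in> odds F"
      using two_coloured_drop_first[OF j _ new[OF F]] notL[of "succ j" M] succ_less[OF j] M by auto
    obtain k where k: "k \<in> odds F" "shift j k = Suc M"
      using two_coloured_drop_last[OF j new[OF F]] notL[of j M] j by auto
    have kn: "k < n" using k(1) new[OF F] arc_subset unfolding two_coloured_def by blast
    \<comment> \<open>The ends are at distance \<open>Suc M\<close>, at least 2, so that
      \<open>succ j\<close> lies strictly between them.\<close>
    have jk: "j \<noteq> succ j" "k \<noteq> succ j"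
      using k(2) M j by (auto simp: succ_def shift_def split: if_splits)
    \<comment> \<open>Without even nodes, \<open>F\<close> would belong to the odd simplex boundary
      and thus to \<open>?L\<close>.\<close>
    have "odds F \<subset> {..<n}"
      using new[OF F] arc_psubset[of "Suc M" j] M j unfolding two_coloured_def by auto
    then have "evens F \<noteq> {}"
      using F unfolding arc_complex_def by blast
    then obtain e where e: "e \<in> evens F" by blast
    obtain j' m' where jm: "(j', m') \<in> {..<n} \<times> {..M} \<union> J \<times> {Suc M}"
      and G': "two_coloured j' m' (F - {Odd (succ j)})"
      using G e \<open>j \<in> odds F\<close> jk unfolding arc_complex_def by auto
    have "succ j \<in> arc j' m'"
    proof (rule succ_in_arc_between[OF j _ kn k(2)])
      show "e \<in> coarc j (Suc M)" using e new[OF F] by (auto simp: two_coloured_def)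
      show "j' < n" using jm J by auto
    qed (use G' e k jk \<open>j \<in> odds F\<close> in \<open>auto simp: two_coloured_def\<close>)
    then have "two_coloured j' m' F"
      using G' unfolding two_coloured_def by auto
    then show False using notL[OF jm] by blast
  qed
qed (simp_all add: finite_arc_complex arc_complex_empty)

text \<open>The arcs of the current greatest length are removed one by one. The process stops at
  \<open>m = 1\<close>, since the apex must be an inner node of the arc.\<close>

lemma arc_complex_short_arcs:
  "geometric_realization (arc_complex ({..<n} \<times> {..n - 3})) homotopy_equivalent_space
     geometric_realization (arc_complex ({..<n} \<times> {..1}))"
proof -
  have step: "geometric_realization (arc_complex ({..<n} \<times> {..M} \<union> J \<times> {Suc M}))
      homotopy_equivalent_space geometric_realization (arc_complex ({..<n} \<times> {..M}))"
    if "finite J" "J \<subseteq> {..<n}" "1 \<le> M" "Suc M + 3 \<le> n" for J M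
    using that(1,2)
  proof (induction J)
    case empty
    then show ?case by (simp add: homotopy_equivalent_space_refl)
  next
    case (insert j J)
    then show ?case
      using arc_complex_remove_arc[OF that(3,4), of j J] homotopy_eqv_trans by auto
  qed
  have "geometric_realization (arc_complex ({..<n} \<times> {..1 + d})) homotopy_equivalent_space
     geometric_realization (arc_complex ({..<n} \<times> {..1}))" if "1 + d + 3 \<le> n" for d
    using that
  proof (induction d)
    case 0
    then show ?case by (simp add: homotopy_equivalent_space_refl)
  next
    case (Suc d)
    have "{..<n} \<times> {..1 + Suc d} = {..<n} \<times> {..1 + d} \<union> {..<n} \<times> {Suc (1 + d)}"
      by auto
    then have "geometric_realization (arc_complex ({..<n} \<times> {..1 + Suc d}))
        homotopy_equivalent_space geometric_realization (arc_complex ({..<n} \<times> {..1 + d}))"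
      using step[of "{..<n}" "1 + d"] Suc.prems by auto
    then show ?case
      using Suc homotopy_eqv_trans by auto
  qed
  moreover have "1 + (n - 4) = n - 3" "1 + (n - 4) + 3 \<le> n"
    using n_ge_4 by auto
  ultimately show ?thesis by metis
qed


section \<open>Thin faces\<close>

definition thin :: "node set \<Rightarrow> bool" where
  "thin F \<longleftrightarrow> (\<exists>j<n. \<exists>m\<le>1. two_coloured j m F \<and> mids F \<subseteq> arc j m)"

lemma thinI:
  assumes "j < n" "m \<le> 1" "odds F \<subseteq> arc j m" "mids F \<subseteq> arc j m" "evens F \<subseteq> coarc j m"
  shows "thin F"
  unfolding thin_def two_coloured_def using assms by blast

lemma thinE:
  assumes "thin F"
  obtains j m where "j < n" "m \<le> 1" "odds F \<subseteq> arc j m" "mids F \<subseteq> arc j m" "evens F \<subseteq> coarc j m"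
  using assms unfolding thin_def two_coloured_def by blast

lemma thin_mono: "thin F \<Longrightarrow> G \<subseteq> F \<Longrightarrow> thin G"
  unfolding thin_def using two_coloured_mono mids_mono by (meson order_trans)

lemma thin_subset:
  "thin F \<Longrightarrow> evens F \<subseteq> {..<n} \<and> odds F \<subseteq> {..<n} \<and> mids F \<subseteq> {..<n}"
  unfolding thin_def two_coloured_def using arc_subset coarc_subset by blast

lemma thin_cong:
  "evens F = evens G \<Longrightarrow> odds F = odds G \<Longrightarrow> mids F = mids G \<Longrightarrow> thin F \<longleftrightarrow> thin G"
  by (simp add: thin_def two_coloured_def)

lemma thin_simps [simp]:
  "thin (insert Top F) = thin F" "thin (insert Bot F) = thin F"
  "thin (F - {Top}) = thin F" "thin (F - {Bot}) = thin F"
  by (rule thin_cong; simp)+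

text \<open>One arc bounds both the odd and the \<open>Mid\<close> nodes, so each of
  \<open>Odd k\<close> and \<open>Mid k\<close> may be added to a face that contains the other. This
  makes either of them an apex over the other.\<close>

lemma thin_insert_Odd: "thin F \<Longrightarrow> k \<in> mids F \<Longrightarrow> thin (insert (Odd k) F)"
  by (erule thinE, rule thinI) auto

lemma thin_insert_Mid: "thin F \<Longrightarrow> k \<in> odds F \<Longrightarrow> thin (insert (Mid k) F)"
  by (erule thinE, rule thinI) auto

text \<open>The arc excludes two consecutive even indices, at most one of which is 0. Thus the even
  nodes of a thin face lie in the closed star of \<open>Even 0\<close>.\<close>

lemma thin_evens: "thin F \<Longrightarrow> insert 0 (evens F) \<subset> {..<n}"
proof -
  assume "thin F"
  then obtain j m where jm: "j < n" "evens F \<subseteq> coarc j m"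
    by (auto simp: thin_def two_coloured_def)
  have "j \<notin> coarc j m" "succ j \<notin> coarc j m" "succ j \<noteq> j" "succ j < n"
    using jm(1) n_ge_4 by (auto simp: coarc_def shift_def succ_def)
  then have "(if j = 0 then succ j else j) \<in> {..<n} - insert 0 (evens F)"
    using jm by auto
  moreover have "insert 0 (evens F) \<subseteq> {..<n}"
    using jm coarc_subset n_ge_4 by auto
  ultimately show ?thesis by blast
qed

text \<open>Two odd indices and 0 are fewer than \<open>n\<close>. The witness \<open>1\<close>
  serves the arcs that start at \<open>n - 2\<close> or \<open>n - 1\<close>, where
  \<open>j + 2\<close> would wrap around.\<close>

lemma thin_odds: "thin F \<Longrightarrow> insert 0 (odds F) \<subset> {..<n}"
proof -
  assume "thin F"
  then obtain j m where jm: "j < n" "m \<le> 1" "odds F \<subseteq> arc j m"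
    by (auto simp: thin_def two_coloured_def)
  have "(if j + 2 < n then j + 2 else 1) \<in> {..<n} - insert 0 (arc j m)"
    using jm n_ge_4 by (auto simp: arc_def shift_def)
  moreover have "insert 0 (odds F) \<subseteq> {..<n}"
    using jm arc_subset n_ge_4 by auto
  ultimately show ?thesis using jm(3) by blast
qed

text \<open>Every arc through \<open>k\<close> excludes at least the even indices that
  \<open>arc k 0\<close> excludes, so the face may be assigned to that arc, whose coarc starts at
  \<open>k + 2\<close>. The node to be added depends on the \<open>Mid\<close> nodes alone, as an
  apex for a label must.\<close>

lemma thin_insert_Even1:
  assumes "thin F" "odds F = {}" "mids F = {k}"
  shows "thin (insert (Even ((k + 2) mod n)) F)"
proof -
  obtain j m where jm: "j < n" "m \<le> 1" "k \<in> arc j m" "evens F \<subseteq> coarc j m"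
    using assms by (auto simp: thin_def two_coloured_def)
  have k: "k < n" using jm arc_subset by auto
  have "coarc j m \<subseteq> coarc k 0" "k \<in> arc k 0"
    using jm by (auto simp: arc_def coarc_def shift_def split: if_splits)
  moreover have "(k + 2) mod n = (if k + 2 < n then k + 2 else k + 2 - n)"
    using k n_ge_4 by (simp add: mod_if)
  then have "(k + 2) mod n \<in> coarc k 0"
    using k n_ge_4 by (auto simp: coarc_def shift_def)
  ultimately show ?thesis
    using assms jm k by (intro thinI[of k 0]) auto
qed

lemma arc_1: "j < n \<Longrightarrow> arc j 1 = {j, succ j}"
  using n_ge_4 by (auto simp: arc_def shift_def succ_def)

lemma arc_0: "j < n \<Longrightarrow> arc j 0 = {j}"
  using n_ge_4 by (auto simp: arc_def shift_def)

text \<open>Two consecutive \<open>Mid\<close> nodes determine the arc; its coarc starts at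
  \<open>k + 3\<close> and is nonempty because \<open>n \<ge> 4\<close>.\<close>

lemma thin_insert_Even2:
  assumes "thin F" "odds F = {}" "mids F = {k, succ k}" "k < n"
  shows "thin (insert (Even ((k + 3) mod n)) F)"
proof -
  obtain j m where jm: "j < n" "m \<le> 1" "{k, succ k} \<subseteq> arc j m" "evens F \<subseteq> coarc j m"
    using assms by (auto simp: thin_def two_coloured_def)
  have "succ k \<noteq> k" using n_ge_4 by (auto simp: succ_def)
  then have m: "m = 1" using jm arc_0[OF jm(1)] by (cases m) auto
  have "j = k"
    using jm(1,3) n_ge_4 assms(4) unfolding m arc_1[OF jm(1)] by (auto simp: succ_def split: if_splits)
  moreover have "(k + 3) mod n = (if k + 3 < n then k + 3 else k + 3 - n)"
    using assms(4) n_ge_4 by (simp add: mod_if)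
  then have "(k + 3) mod n \<in> coarc k 1"
    using assms(4) n_ge_4 by (auto simp: coarc_def shift_def)
  ultimately show ?thesis
    using assms jm m by (intro thinI[of k 1]) auto
qed

text \<open>So the \<open>Mid\<close> nodes of thin faces span a circle with \<open>n\<close> nodes
  and \<open>n\<close> edges.\<close>

lemma thin_mids_cases:
  assumes "thin F"
  obtains "mids F = {}" | k where "k < n" "mids F = {k}" | k where "k < n" "mids F = {k, succ k}"
proof -
  obtain j m where jm: "j < n" "m \<le> 1" "mids F \<subseteq> arc j m"
    using assms by (auto simp: thin_def)
  then have "arc j m \<subseteq> {j, succ j}"
    using arc_0 arc_1 by (cases m) auto
  then have "mids F = {} \<or> mids F = {j} \<or> mids F = {succ j} \<or> mids F = {j, succ j}"
    using jm by blast
  then show thesis using that jm(1) succ_less by blast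
qed

subsection \<open>The equator\<close>

definition "even_boundary F \<longleftrightarrow> mids F = {} \<and> odds F = {} \<and> evens F \<subset> {..<n}"
definition "odd_boundary F \<longleftrightarrow> mids F = {} \<and> evens F = {} \<and> odds F \<subset> {..<n}"

definition with_equator :: "node set set" where
  "with_equator = {F. Top \<notin> F \<and> Bot \<notin> F \<and> (even_boundary F \<or> odd_boundary F \<or> thin F)}"

text \<open>An even and an odd half, which meet only in the circle of \<open>Mid\<close>
  nodes.\<close>

definition two_sided :: "node set set" where
  "two_sided = {F. Top \<notin> F \<and> Bot \<notin> F \<and>
    (even_boundary F \<or> odd_boundary F \<or> thin F \<and> (evens F = {} \<or> odds F = {}))}"

text \<open>The last disjunct is the cone with apex \<open>Top\<close> over the even half without
  the facet opposite to \<open>Even 0\<close>.\<close>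

definition even_coned :: "node set set" where
  "even_coned = {F. Bot \<notin> F \<and> (Top \<notin> F \<and> (even_boundary F \<or> odd_boundary F \<or> thin F \<and> evens F = {}) \<or>
    odds F = {} \<and> (thin F \<or> mids F = {} \<and> insert 0 (evens F) \<subset> {..<n}))}"

text \<open>In a cap the pole has taken the place of the node \<open>0\<close>.\<close>

definition "even_cap F \<longleftrightarrow> Bot \<notin> F \<and> mids F = {} \<and> odds F = {} \<and>
  (if Top \<in> F then evens F \<subset> {0<..<n} else evens F \<subseteq> {0<..<n})"
definition "odd_cap F \<longleftrightarrow> Top \<notin> F \<and> mids F = {} \<and> evens F = {} \<and>
  (if Bot \<in> F then odds F \<subset> {0<..<n} else odds F \<subseteq> {0<..<n})"

definition even_capped :: "node set set" where
  "even_capped = {F. Bot \<notin> F \<and> (even_cap F \<or> Top \<notin> F \<and> (odd_boundary F \<or> thin F \<and> evens F = {}) \<or>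
     odds F = {} \<and> evens F = {} \<and> thin F)}"

definition odd_coned :: "node set set" where
  "odd_coned = {F. even_cap F \<or> Top \<notin> F \<and> Bot \<notin> F \<and> odd_boundary F \<or>
     Bot \<notin> F \<and> odds F = {} \<and> evens F = {} \<and> thin F \<or>
     Top \<notin> F \<and> evens F = {} \<and> (thin F \<or> mids F = {} \<and> insert 0 (odds F) \<subset> {..<n})}"

definition bipyramid :: "node set set" where
  "bipyramid = {F. even_cap F \<or> odd_cap F \<or>
     evens F = {} \<and> odds F = {} \<and> thin F \<and> \<not> {Top, Bot} \<subseteq> F}"

definition filled_axis :: "node set set" where
  "filled_axis = {F. even_cap F \<or> odd_cap F \<or> evens F = {} \<and> odds F = {} \<and>
     (thin F \<and> \<not> {Top, Bot} \<subseteq> F \<or> (\<exists>k. Suc k < n \<and> mids F \<subseteq> {k, Suc k}))}"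

definition tetrahedron :: "node set" where
  "tetrahedron = {Top, Bot, Mid 0, Mid (n - 1)}"

definition with_tetrahedron :: "node set set" where
  "with_tetrahedron = {F. even_cap F \<or> odd_cap F \<or> F \<subset> tetrahedron}"

text \<open>The last disjunct is the join of the edge from \<open>Top\<close> to \<open>Bot\<close>
  with the boundary of the simplex on the odd nodes other than \<open>Odd 0\<close>; it can be
  collapsed towards either end of the edge.\<close>

definition joined_poles :: "node set set" where
  "joined_poles = {F. even_cap F \<or> odd_cap F \<or> F \<subset> tetrahedron \<or>
     evens F = {} \<and> mids F = {} \<and> odds F \<subset> {0<..<n}}"

definition simplex_wedge :: "node set set" where
  "simplex_wedge = {F. even_cap F \<or> F \<subset> tetrahedron \<or>
     Bot \<notin> F \<and> evens F = {} \<and> mids F = {} \<and>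
       (if Top \<in> F then odds F \<subset> {0<..<n} else odds F \<subseteq> {0<..<n})}"

section \<open>Downward closed predicates and finiteness of the complexes\<close>

definition hereditary :: "(node set \<Rightarrow> bool) \<Rightarrow> bool" where
  "hereditary P \<longleftrightarrow> (\<forall>F G. P F \<longrightarrow> G \<subseteq> F \<longrightarrow> P G)"

text \<open>All complexes in the chain are combined from a few downward closed conditions, so
  closure under subfaces follows from the shape of their definitions.\<close>

lemma hereditary_junctors:
  "hereditary P \<Longrightarrow> hereditary Q \<Longrightarrow> hereditary (\<lambda>F. P F \<and> Q F)"
  "hereditary P \<Longrightarrow> hereditary Q \<Longrightarrow> hereditary (\<lambda>F. P F \<or> Q F)"
  "(\<And>k. hereditary (R k)) \<Longrightarrow> hereditary (\<lambda>F. \<exists>k. R k F)"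
  "hereditary (\<lambda>F. c)"
  unfolding hereditary_def by blast+

lemma hereditary_atoms:
  "hereditary (\<lambda>F. v \<notin> F)" "hereditary (\<lambda>F. \<not> S \<subseteq> F)" "hereditary (\<lambda>F. F \<subset> S)"
  unfolding hereditary_def by blast+

lemma hereditary_empty:
  "hereditary (\<lambda>F. evens F = {})" "hereditary (\<lambda>F. odds F = {})" "hereditary (\<lambda>F. mids F = {})"
  unfolding hereditary_def using evens_mono odds_mono mids_mono by (metis subset_empty)+

lemma hereditary_bounds:
  "hereditary (\<lambda>F. evens F \<subset> A)" "hereditary (\<lambda>F. odds F \<subset> A)" "hereditary (\<lambda>F. mids F \<subseteq> A)"
  unfolding hereditary_def using evens_mono odds_mono mids_mono
  by (meson order_le_less_trans order_trans)+

lemma hereditary_insert_bounds: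
  "hereditary (\<lambda>F. insert k (evens F) \<subset> A)" "hereditary (\<lambda>F. insert k (odds F) \<subset> A)"
  unfolding hereditary_def using evens_mono odds_mono
  by (meson order_le_less_trans insert_mono)+

text \<open>The conditional is treated as a single atom, because \<open>v \<in> F\<close> is not
  inherited by subfaces. Losing \<open>v\<close> only relaxes the bound.\<close>

lemma hereditary_caps:
  "hereditary (\<lambda>F. if v \<in> F then evens F \<subset> A else evens F \<subseteq> A)"
  "hereditary (\<lambda>F. if v \<in> F then odds F \<subset> A else odds F \<subseteq> A)"
proof -
  have step: "if v \<in> G then B' \<subset> A else B' \<subseteq> A"
    if "if v \<in> F then B \<subset> A else B \<subseteq> A" "G \<subseteq> F" "B' \<subseteq> B" for F G :: "node set" and B B'
    using that by (auto split: if_splits)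
  show "hereditary (\<lambda>F. if v \<in> F then evens F \<subset> A else evens F \<subseteq> A)"
    unfolding hereditary_def
  proof (intro allI impI)
    fix F G :: "node set"
    assume *: "if v \<in> F then evens F \<subset> A else evens F \<subseteq> A" "G \<subseteq> F"
    show "if v \<in> G then evens G \<subset> A else evens G \<subseteq> A"
      by (rule step[OF * evens_mono[OF *(2)]])
  qed
  show "hereditary (\<lambda>F. if v \<in> F then odds F \<subset> A else odds F \<subseteq> A)"
    unfolding hereditary_def
  proof (intro allI impI)
    fix F G :: "node set"
    assume *: "if v \<in> F then odds F \<subset> A else odds F \<subseteq> A" "G \<subseteq> F"
    show "if v \<in> G then odds G \<subset> A else odds G \<subseteq> A"
      by (rule step[OF * odds_mono[OF *(2)]])
  qed
qed

lemma hereditary_thin: "hereditary thin"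
  unfolding hereditary_def using thin_mono by blast

lemma hereditary_shapes:
  "hereditary even_boundary" "hereditary odd_boundary" "hereditary even_cap" "hereditary odd_cap"
  unfolding even_boundary_def[abs_def] odd_boundary_def[abs_def] even_cap_def[abs_def] odd_cap_def[abs_def]
  by (intro hereditary_junctors hereditary_atoms hereditary_empty hereditary_bounds hereditary_caps)+

lemmas hereditary_intros = hereditary_junctors hereditary_atoms hereditary_empty hereditary_bounds
  hereditary_insert_bounds hereditary_caps hereditary_thin hereditary_shapes

definition inner :: "node set \<Rightarrow> bool" where
  "inner F \<longleftrightarrow> evens F \<subseteq> {..<n} \<and> odds F \<subseteq> {..<n} \<and> mids F \<subseteq> {..<n}"

lemma inner_shapes:
  "even_boundary F \<Longrightarrow> inner F" "odd_boundary F \<Longrightarrow> inner F" "even_cap F \<Longrightarrow> inner F"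
  "odd_cap F \<Longrightarrow> inner F" "thin F \<Longrightarrow> inner F" "F \<subset> tetrahedron \<Longrightarrow> inner F"
  using n_ge_4 thin_subset[of F]
  by (auto simp: inner_def even_boundary_def odd_boundary_def even_cap_def odd_cap_def
      tetrahedron_def evens_def odds_def mids_def split: if_splits)

lemma finite_complex_hereditary:
  assumes "hereditary P" "\<And>F. P F \<Longrightarrow> inner F"
  shows "finite_complex {F. P F}"
proof (rule finite_node_complexI)
  show "evens F \<subseteq> {..<n} \<and> odds F \<subseteq> {..<n} \<and> mids F \<subseteq> {..<n}" if "F \<in> {F. P F}" for F
    using assms(2) that by (simp add: inner_def)
  show "G \<in> {F. P F}" if "F \<in> {F. P F}" "G \<subseteq> F" for F G
    using assms(1) that by (auto simp: hereditary_def)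
qed

lemma inner_bounds:
  "mids F = {} \<Longrightarrow> odds F = {} \<Longrightarrow> insert 0 (evens F) \<subset> {..<n} \<Longrightarrow> inner F"
  "mids F = {} \<Longrightarrow> evens F = {} \<Longrightarrow> insert 0 (odds F) \<subset> {..<n} \<Longrightarrow> inner F"
  "evens F = {} \<Longrightarrow> odds F = {} \<Longrightarrow> Suc k < n \<Longrightarrow> mids F \<subseteq> {k, Suc k} \<Longrightarrow> inner F"
  "mids F = {} \<Longrightarrow> evens F = {} \<Longrightarrow> odds F \<subset> {0<..<n} \<Longrightarrow> inner F"
  "mids F = {} \<Longrightarrow> evens F = {} \<Longrightarrow>
     (if v \<in> F then odds F \<subset> {0<..<n} else odds F \<subseteq> {0<..<n}) \<Longrightarrow> inner F"
  by (auto simp: inner_def split: if_splits)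

lemma finite_with_equator: "finite_complex with_equator"
  unfolding with_equator_def
proof (rule finite_complex_hereditary)
  show "inner F" if
    "Top \<notin> F \<and> Bot \<notin> F \<and> (even_boundary F \<or> odd_boundary F \<or>
      thin F)" for F
    using that by (elim disjE conjE) (blast intro: inner_shapes inner_bounds)+
qed (intro hereditary_intros)

lemma finite_two_sided: "finite_complex two_sided"
  unfolding two_sided_def
proof (rule finite_complex_hereditary)
  show "inner F" if
    "Top \<notin> F \<and> Bot \<notin> F \<and> (even_boundary F \<or> odd_boundary F \<or>
      thin F \<and> (evens F = {} \<or> odds F = {}))" for F
    using that by (elim disjE conjE) (blast intro: inner_shapes inner_bounds)+
qed (intro hereditary_intros)

lemma finite_even_coned: "finite_complex even_coned"
  unfolding even_coned_def
proof (rule finite_complex_hereditary)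
  show "inner F" if
    "Bot \<notin> F \<and> (Top \<notin> F \<and> (even_boundary F \<or> odd_boundary F \<or>
      thin F \<and> evens F = {}) \<or> odds F = {} \<and> (thin F \<or>
      mids F = {} \<and> insert 0 (evens F) \<subset> {..<n}))" for F
    using that by (elim disjE conjE) (blast intro: inner_shapes inner_bounds)+
qed (intro hereditary_intros)

lemma finite_even_capped: "finite_complex even_capped"
  unfolding even_capped_def
proof (rule finite_complex_hereditary)
  show "inner F" if
    "Bot \<notin> F \<and> (even_cap F \<or> Top \<notin> F \<and> (odd_boundary F \<or>
      thin F \<and> evens F = {}) \<or> odds F = {} \<and> evens F = {} \<and> thin F)" for F
    using that by (elim disjE conjE) (blast intro: inner_shapes inner_bounds)+
qed (intro hereditary_intros)

lemma finite_odd_coned: "finite_complex odd_coned"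
  unfolding odd_coned_def
proof (rule finite_complex_hereditary)
  show "inner F" if
    "even_cap F \<or> Top \<notin> F \<and> Bot \<notin> F \<and> odd_boundary F \<or>
      Bot \<notin> F \<and> odds F = {} \<and> evens F = {} \<and> thin F \<or>
      Top \<notin> F \<and> evens F = {} \<and> (thin F \<or>
      mids F = {} \<and> insert 0 (odds F) \<subset> {..<n})" for F
    using that by (elim disjE conjE) (blast intro: inner_shapes inner_bounds)+
qed (intro hereditary_intros)

lemma finite_bipyramid: "finite_complex bipyramid"
  unfolding bipyramid_def
proof (rule finite_complex_hereditary)
  show "inner F" if
    "even_cap F \<or> odd_cap F \<or>
      evens F = {} \<and> odds F = {} \<and> thin F \<and> \<not> {Top, Bot} \<subseteq> F" for F
    using that by (elim disjE conjE) (blast intro: inner_shapes inner_bounds)+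
qed (intro hereditary_intros)

lemma finite_filled_axis: "finite_complex filled_axis"
  unfolding filled_axis_def
proof (rule finite_complex_hereditary)
  show "inner F" if
    "even_cap F \<or> odd_cap F \<or>
      evens F = {} \<and> odds F = {} \<and> (thin F \<and> \<not> {Top, Bot} \<subseteq> F \<or>
      (\<exists>k. Suc k < n \<and> mids F \<subseteq> {k, Suc k}))" for F
    using that by (elim disjE conjE) (blast intro: inner_shapes inner_bounds)+
qed (intro hereditary_intros)

lemma finite_with_tetrahedron: "finite_complex with_tetrahedron"
  unfolding with_tetrahedron_def
proof (rule finite_complex_hereditary)
  show "inner F" if "even_cap F \<or> odd_cap F \<or> F \<subset> tetrahedron" for F
    using that by (elim disjE conjE) (blast intro: inner_shapes inner_bounds)+
qed (intro hereditary_intros)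

lemma finite_joined_poles: "finite_complex joined_poles"
  unfolding joined_poles_def
proof (rule finite_complex_hereditary)
  show "inner F" if
    "even_cap F \<or> odd_cap F \<or> F \<subset> tetrahedron \<or>
      evens F = {} \<and> mids F = {} \<and> odds F \<subset> {0<..<n}" for F
    using that by (elim disjE conjE) (blast intro: inner_shapes inner_bounds)+
qed (intro hereditary_intros)

lemma finite_simplex_wedge: "finite_complex simplex_wedge"
  unfolding simplex_wedge_def
proof (rule finite_complex_hereditary)
  show "inner F" if
    "even_cap F \<or> F \<subset> tetrahedron \<or>
      Bot \<notin> F \<and> evens F = {} \<and> mids F = {} \<and> (if Top \<in> F then odds F \<subset> {0<..<n} else odds F \<subseteq> {0<..<n})" for F
    using that by (elim disjE conjE) (blast intro: inner_shapes inner_bounds)+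
qed (intro hereditary_intros)

lemma faces_empty:
  "{} \<in> with_equator" "{} \<in> two_sided" "{} \<in> even_coned" "{} \<in> even_capped" "{} \<in> odd_coned"
    "{} \<in> bipyramid" "{} \<in> filled_axis" "{} \<in> with_tetrahedron"
  "{} \<in> joined_poles" "{} \<in> simplex_wedge"
proof -
  have "0 \<in> {..<n}" using n_ge_4 by simp
  then have "even_boundary {}" "even_cap {}"
    by (auto simp: even_boundary_def even_cap_def)
  then show "{} \<in> with_equator" "{} \<in> two_sided" "{} \<in> even_coned" "{} \<in> even_capped" "{} \<in> odd_coned"
    "{} \<in> bipyramid" "{} \<in> filled_axis" "{} \<in> with_tetrahedron"
    "{} \<in> joined_poles" "{} \<in> simplex_wedge"
    by (simp_all add: with_equator_def two_sided_def even_coned_def even_capped_def odd_coned_def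
        bipyramid_def filled_axis_def with_tetrahedron_def joined_poles_def simplex_wedge_def)
qed

section \<open>From thin faces to the suspended circle\<close>

lemma arc_complex_1: "arc_complex ({..<n} \<times> {..1}) = {F. Top \<notin> F \<and> Bot \<notin> F \<and>
    (even_boundary F \<or> odd_boundary F \<or> mids F = {} \<and> thin F)}"
proof -
  have "(\<exists>(j, m)\<in>{..<n} \<times> {..1}. two_coloured j m F) \<longleftrightarrow> thin F" if "mids F = {}" for F
    using that by (auto simp: thin_def)
  then show ?thesis
    by (auto simp: arc_complex_def even_boundary_def odd_boundary_def)
qed

text \<open>The new faces are sorted by their \<open>Mid\<close> nodes. For any such
  \<open>k\<close>, the node \<open>Odd k\<close> is an apex, and adding or deleting it does not
  change the label.\<close>

lemma with_equator_arc_complex: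
  "geometric_realization with_equator homotopy_equivalent_space
     geometric_realization (arc_complex ({..<n} \<times> {..1}))"
  (is "_ homotopy_equivalent_space geometric_realization ?L")
proof (rule homotopy_equivalent_labelled_collapse[where lab = mids])
  have L: "F \<in> ?L \<longleftrightarrow> Top \<notin> F \<and> Bot \<notin> F \<and>
    (even_boundary F \<or> odd_boundary F \<or> mids F = {} \<and> thin F)" for F
    unfolding arc_complex_1 by simp
  show "?L \<subseteq> with_equator" by (rule subsetI) (use L in \<open>auto simp: with_equator_def\<close>)
  show "{} \<in> ?L" by (rule arc_complex_empty)
  have *: "mids F \<noteq> {} \<and> thin F" if "F \<in> with_equator - ?L" for F
    using that unfolding Diff_iff L by (auto simp: with_equator_def even_boundary_def odd_boundary_def)
  show "\<exists>v. \<forall>G\<in>with_equator - ?L. mids G = mids F \<longrightarrow>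
      insert v G \<in> with_equator \<and> G - {v} \<notin> ?L \<and> mids (insert v G) = mids F \<and> mids (G - {v}) = mids F"
    if F: "F \<in> with_equator - ?L" for F
  proof -
    obtain k where k: "k \<in> mids F" using *[OF F] by blast
    have "insert (Odd k) G \<in> with_equator" "G - {Odd k} \<notin> ?L" if "G \<in> with_equator - ?L" "mids G = mids F" for G
      using k thin_insert_Odd[of G k] *[OF that(1)] that unfolding Diff_iff L
      by (auto simp: with_equator_def even_boundary_def odd_boundary_def)
    then show ?thesis by (intro exI[of _ "Odd k"]) simp
  qed
qed (simp_all add: mids_mono finite_with_equator finite_arc_complex)

text \<open>Here the roles are exchanged: a face with both even and odd nodes is sorted by its odd
  nodes, and \<open>Mid k\<close> is an apex for any odd index \<open>k\<close> in it. What is left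
  joins the two colours only through the circle.\<close>

lemma with_equator_two_sided:
  "geometric_realization with_equator homotopy_equivalent_space
     geometric_realization two_sided"
proof (rule homotopy_equivalent_labelled_collapse[where lab = odds])
  have *: "odds F \<noteq> {} \<and> evens F \<noteq> {} \<and> thin F" if "F \<in> with_equator - two_sided" for F
    using that by (auto simp: with_equator_def two_sided_def)
  show "\<exists>v. \<forall>G\<in>with_equator - two_sided. odds G = odds F \<longrightarrow>
      insert v G \<in> with_equator \<and> G - {v} \<notin> two_sided \<and> odds (insert v G) = odds F \<and> odds (G - {v}) = odds F"
    if F: "F \<in> with_equator - two_sided" for F
  proof -
    obtain k where k: "k \<in> odds F" using *[OF F] by blast
    have "insert (Mid k) G \<in> with_equator" "G - {Mid k} \<notin> two_sided" if "G \<in> with_equator - two_sided" "odds G = odds F" for G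
      using k thin_insert_Mid[of G k] *[OF that(1)] that
      by (auto simp: with_equator_def two_sided_def even_boundary_def odd_boundary_def)
    then show ?thesis by (intro exI[of _ "Mid k"]) simp
  qed
qed (auto simp: with_equator_def two_sided_def odds_mono
    finite_with_equator[unfolded with_equator_def]
    finite_two_sided[unfolded two_sided_def]
    faces_empty(2)[unfolded two_sided_def, simplified])

lemma boundary_if_insert:
  "mids F = {} \<Longrightarrow> odds F = {} \<Longrightarrow> insert 0 (evens F) \<subset> {..<n} \<Longrightarrow> even_boundary F"
  "mids F = {} \<Longrightarrow> evens F = {} \<Longrightarrow> insert 0 (odds F) \<subset> {..<n} \<Longrightarrow> odd_boundary F"
  unfolding even_boundary_def odd_boundary_def by blast+

text \<open>Over a fixed face of the circle the faces that contain \<open>Top\<close> have an even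
  apex: \<open>Even 0\<close> over the empty face, and the first even node not excluded by the arc
  over a node or an edge.\<close>

lemma even_coned_two_sided:
  "geometric_realization even_coned homotopy_equivalent_space
     geometric_realization two_sided"
proof (rule homotopy_equivalent_labelled_collapse[where lab = mids])
  show sub: "two_sided \<subseteq> even_coned"
    using n_ge_4 by (auto simp: two_sided_def even_coned_def even_boundary_def thin_evens)
  have *: "Top \<in> F \<and> Bot \<notin> F \<and> odds F = {} \<and> (thin F \<or> mids F = {}) \<and>
      insert 0 (evens F) \<subset> {..<n}" if "F \<in> even_coned - two_sided" for F
    using that thin_evens[of F] boundary_if_insert(1)[of F]
    unfolding two_sided_def even_coned_def by blast
  have not_2: "G - {Even k} \<notin> two_sided" if "G \<in> even_coned - two_sided" for G k
    using *[OF that] by (simp add: two_sided_def)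
  show "\<exists>v. \<forall>G\<in>even_coned - two_sided. mids G = mids F \<longrightarrow>
      insert v G \<in> even_coned \<and> G - {v} \<notin> two_sided \<and> mids (insert v G) = mids F \<and> mids (G - {v}) = mids F"
    if F: "F \<in> even_coned - two_sided" for F
  proof -
    have "thin F \<or> mids F = {}" using *[OF F] by blast
    then consider "mids F = {}" | k where "k < n" "mids F = {k}" | k where "k < n" "mids F = {k, succ k}"
      using thin_mids_cases by metis
    then obtain l where l: "insert (Even l) G \<in> even_coned" if "G \<in> even_coned - two_sided" "mids G = mids F" for G
    proof cases
      case 1
      show thesis
      proof (rule that)
        show "insert (Even 0) G \<in> even_coned" if "G \<in> even_coned - two_sided" "mids G = mids F" for G
          using *[OF that(1)] that(2) 1 by (simp add: even_coned_def)
      qed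
    next
      case 2
      show thesis
      proof (rule that)
        show "insert (Even ((k + 2) mod n)) G \<in> even_coned" if "G \<in> even_coned - two_sided" "mids G = mids F" for G
          using *[OF that(1)] that(2) 2 thin_insert_Even1[of G k] by (simp add: even_coned_def)
      qed
    next
      case 3
      show thesis
      proof (rule that)
        show "insert (Even ((k + 3) mod n)) G \<in> even_coned" if "G \<in> even_coned - two_sided" "mids G = mids F" for G
          using *[OF that(1)] that(2) 3 thin_insert_Even2[of G k] by (simp add: even_coned_def)
      qed
    qed
    then show ?thesis
      using not_2 by (intro exI[of _ "Even l"]) simp
  qed
qed (simp_all add: mids_mono finite_two_sided finite_even_coned faces_empty)

lemma lessThan_eq_insert: "{..<n} = insert 0 {0<..<n}"
  using n_ge_4 by auto

lemma psubset_insert_insert: "k \<notin> A \<Longrightarrow> k \<notin> B \<Longrightarrow> insert k A \<subset> insert k B \<longleftrightarrow> A \<subset> B"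
  by (simp add: psubset_eq insert_ident) blast

lemma psubset_insert_iff_subset: "k \<notin> A \<Longrightarrow> A \<subset> insert k B \<longleftrightarrow> A \<subseteq> B"
  by (auto simp: psubset_eq subset_insert)

lemma greaterThanLessThan_iffs:
  assumes "0 \<notin> A"
  shows "A \<subset> {0<..<n} \<longleftrightarrow> insert 0 A \<subset> {..<n}" "A \<subseteq> {0<..<n} \<longleftrightarrow> A \<subset> {..<n}"
  unfolding lessThan_eq_insert
  using assms psubset_insert_insert[of 0 A "{0<..<n}"] psubset_insert_iff_subset[of 0 A "{0<..<n}"]
  by simp_all

lemma greaterThanLessThan_zero: "A \<subseteq> {0<..<n} \<Longrightarrow> 0 \<notin> A"
  by auto

text \<open>Brings the cap into the form used by the cone, with \<open>Top\<close> read as the index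
  0, so that the comparison of the two becomes propositional.\<close>

lemma even_cap_iff: "even_cap F \<longleftrightarrow> Bot \<notin> F \<and> mids F = {} \<and> odds F = {} \<and> 0 \<notin> evens F \<and>
    (if Top \<in> F then insert 0 (evens F) \<subset> {..<n} else evens F \<subset> {..<n})"
proof (cases "0 \<in> evens F")
  case True
  then have "\<not> evens F \<subseteq> {0<..<n}" "\<not> evens F \<subset> {0<..<n}"
    using greaterThanLessThan_zero[of "evens F"] by blast+
  then show ?thesis using True by (simp add: even_cap_def)
next
  case False
  then show ?thesis unfolding even_cap_def greaterThanLessThan_iffs[OF False] by simp
qed

lemma odd_cap_iff: "odd_cap F \<longleftrightarrow> Top \<notin> F \<and> mids F = {} \<and> evens F = {} \<and> 0 \<notin> odds F \<and>
    (if Bot \<in> F then insert 0 (odds F) \<subset> {..<n} else odds F \<subset> {..<n})"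
proof (cases "0 \<in> odds F")
  case True
  then have "\<not> odds F \<subseteq> {0<..<n}" "\<not> odds F \<subset> {0<..<n}"
    using greaterThanLessThan_zero[of "odds F"] by blast+
  then show ?thesis using True by (simp add: odd_cap_def)
next
  case False
  then show ?thesis unfolding odd_cap_def greaterThanLessThan_iffs[OF False] by simp
qed

text \<open>The conditions that cut the smaller complex out of the cone do not mention
  \<open>Top\<close>, which therefore can serve as the apex of a collapse.\<close>

lemma even_capped_iff: "F \<in> even_capped \<longleftrightarrow> F \<in> even_coned \<and> (mids F = {} \<or> evens F = {}) \<and> 0 \<notin> evens F"
proof -
  have "thin F \<Longrightarrow> insert 0 (evens F) \<subset> {..<n}" by (rule thin_evens)
  moreover have "insert 0 (evens F) \<subset> {..<n} \<Longrightarrow> evens F \<subset> {..<n}" by blast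
  moreover have "evens F = {} \<Longrightarrow> 0 \<notin> evens F" by simp
  ultimately show ?thesis
    unfolding even_capped_def even_coned_def even_cap_iff even_boundary_def odd_boundary_def mem_Collect_eq
    by (smt (verit))
qed

text \<open>The removed faces contain \<open>Even 0\<close>, or else both even and
  \<open>Mid\<close> nodes; all of them lie in the cone over \<open>Top\<close>. Their removal
  detaches the circle from the even nodes and puts \<open>Top\<close> in the place of
  \<open>Even 0\<close>.\<close>

lemma even_coned_even_capped:
  "geometric_realization even_coned homotopy_equivalent_space
     geometric_realization even_capped"
proof (rule homotopy_equivalent_cone_collapse[where v = Top])
  show "insert Top F \<in> even_coned" if "F \<in> even_coned - even_capped" for F
    using that thin_evens[of F]
    by (auto simp: even_capped_iff) (auto simp: even_coned_def even_boundary_def odd_boundary_def insert_absorb)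
  show "F - {Top} \<notin> even_capped" if "F \<in> even_coned - even_capped" for F
    using that by (auto simp: even_capped_iff)
qed (auto simp: even_capped_iff finite_even_coned finite_even_capped faces_empty)

text \<open>On the odd side the apex over a nonempty set of \<open>Mid\<close> nodes is any
  \<open>Odd k\<close> with \<open>k\<close> in the set, since \<open>Mid k\<close> and
  \<open>Odd k\<close> obey the same arc; over the empty set it is \<open>Odd 0\<close>.\<close>

lemma odd_coned_even_capped:
  "geometric_realization odd_coned homotopy_equivalent_space
     geometric_realization even_capped"
proof (rule homotopy_equivalent_labelled_collapse[where lab = mids])
  show sub: "even_capped \<subseteq> odd_coned"
    by (auto simp: even_capped_def odd_coned_def)
  have *: "Bot \<in> F \<and> Top \<notin> F \<and> evens F = {} \<and> (thin F \<or> mids F = {}) \<and>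
      insert 0 (odds F) \<subset> {..<n}" if "F \<in> odd_coned - even_capped" for F
    proof -
    have "even_cap F \<Longrightarrow> Bot \<notin> F" by (simp add: even_cap_def)
    then show ?thesis
      using that thin_odds[of F] boundary_if_insert(2)[of F]
      unfolding even_capped_def odd_coned_def Diff_iff mem_Collect_eq by (smt (verit))
  qed
  have not_4: "G - {Odd k} \<notin> even_capped" if "G \<in> odd_coned - even_capped" for G k
    using *[OF that] by (simp add: even_capped_def)
  show "\<exists>v. \<forall>G\<in>odd_coned - even_capped. mids G = mids F \<longrightarrow>
      insert v G \<in> odd_coned \<and> G - {v} \<notin> even_capped \<and> mids (insert v G) = mids F \<and> mids (G - {v}) = mids F"
    if F: "F \<in> odd_coned - even_capped" for F
  proof (cases "mids F = {}")
    case True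
    then have "insert (Odd 0) G \<in> odd_coned" if "G \<in> odd_coned - even_capped" "mids G = mids F" for G
      using *[OF that(1)] that(2) by (simp add: odd_coned_def)
    then show ?thesis using not_4 by (intro exI[of _ "Odd 0"]) simp
  next
    case False
    then obtain k where k: "k \<in> mids F" by blast
    then have "insert (Odd k) G \<in> odd_coned" if "G \<in> odd_coned - even_capped" "mids G = mids F" for G
      using *[OF that(1)] that(2) thin_insert_Odd[of G k] by (auto simp: odd_coned_def)
    then show ?thesis using not_4 by (intro exI[of _ "Odd k"]) simp
  qed
qed (simp_all add: mids_mono finite_even_capped finite_odd_coned faces_empty)

lemma bipyramid_iff: "F \<in> bipyramid \<longleftrightarrow> F \<in> odd_coned \<and> (mids F = {} \<or> odds F = {}) \<and> 0 \<notin> odds F"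
proof -
  have "thin F \<Longrightarrow> insert 0 (odds F) \<subset> {..<n}" by (rule thin_odds)
  moreover have "insert 0 (odds F) \<subset> {..<n} \<Longrightarrow> odds F \<subset> {..<n}" by blast
  moreover have "odds F = {} \<Longrightarrow> 0 \<notin> odds F" by simp
  ultimately show ?thesis
    unfolding odd_coned_def bipyramid_def odd_cap_iff even_cap_iff odd_boundary_def mem_Collect_eq
      insert_subset
    using empty_subsetI[of F] by (smt (verit))
qed

lemma odd_coned_bipyramid:
  "geometric_realization odd_coned homotopy_equivalent_space
     geometric_realization bipyramid"
proof (rule homotopy_equivalent_cone_collapse[where v = Bot])
  show "insert Bot F \<in> odd_coned" if "F \<in> odd_coned - bipyramid" for F
    using that thin_odds[of F]
    by (auto simp: bipyramid_iff) (auto simp: odd_coned_def even_cap_def odd_boundary_def insert_absorb)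
  show "F - {Bot} \<notin> bipyramid" if "F \<in> odd_coned - bipyramid" for F
    using that by (auto simp: bipyramid_iff)
qed (auto simp: bipyramid_iff finite_odd_coned finite_bipyramid faces_empty)

section \<open>From the suspended circle to the wedge\<close>

lemma thin_path:
  assumes "evens F = {}" "odds F = {}" "Suc k < n" "mids F \<subseteq> {k, Suc k}"
  shows "thin F"
  using assms arc_1[of k] by (intro thinI[of k 1]) (auto simp: succ_def)

text \<open>
  The edge between \<open>Top\<close> and \<open>Bot\<close> and the tetrahedra around it, except for one, are glued in
  along a path of nodes on the equator.
\<close>

definition first_mid :: "node set \<Rightarrow> nat" where
  "first_mid F = (if mids F = {} then n - 1 else Min (mids F))"

lemma first_mid_simps:
  "mids F = {} \<Longrightarrow> first_mid F = n - 1" "mids F = {k} \<Longrightarrow> first_mid F = k"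
  "mids F = {k, Suc k} \<Longrightarrow> first_mid F = k"
  by (simp_all add: first_mid_def min_def)

text \<open>Among the faces through the axis, those with first \<open>Mid\<close> index
  \<open>k\<close> are paired by the next node \<open>k + 1\<close> of the path. The default
  \<open>n - 1\<close> of \<open>first_mid\<close> puts the faces without \<open>Mid\<close> nodes
  into the last group, where \<open>Mid (n - 1)\<close> itself is the apex. Larger faces have
  smaller first indices, so the label is subtracted from \<open>n - 1\<close> to become
  monotone.\<close>

lemma filled_axis_bipyramid:
  "geometric_realization filled_axis homotopy_equivalent_space
     geometric_realization bipyramid"
proof (rule homotopy_equivalent_labelled_collapse[where lab = "\<lambda>F. n - 1 - first_mid F"])
  have *: "Top \<in> F" "Bot \<in> F" "evens F = {}" "odds F = {}"
    "\<exists>k. Suc k < n \<and> mids F \<subseteq> {k, Suc k}" if "F \<in> filled_axis - bipyramid" for F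
    using that thin_path[of F] by (auto simp: bipyramid_def filled_axis_def)
  have not_6: "F \<notin> bipyramid" if "Top \<in> F" "Bot \<in> F" for F
    using that by (auto simp: bipyramid_def even_cap_def odd_cap_def)
  have axis_face: "F \<in> filled_axis" if "evens F = {}" "odds F = {}" "Suc k < n" "mids F \<subseteq> {k, Suc k}" for F k
    using that by (auto simp: filled_axis_def)
  have shapes: "mids F = {} \<or> (\<exists>k<n. mids F = {k}) \<or> (\<exists>k. Suc k < n \<and> mids F = {k, Suc k})"
    if F: "F \<in> filled_axis - bipyramid" for F
  proof -
    obtain k where k: "Suc k < n" "mids F \<subseteq> {k, Suc k}" using *(5)[OF F] by blast
    then have "mids F = {} \<or> mids F = {k} \<or> mids F = {Suc k} \<or> mids F = {k, Suc k}" by blast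
    then show ?thesis using k(1) Suc_lessD by blast
  qed
  have le: "first_mid F \<le> n - 1" if F: "F \<in> filled_axis - bipyramid" for F
    using shapes[OF F] first_mid_simps[of F] by force
  show "n - 1 - first_mid F \<le> n - 1 - first_mid G"
    if F: "F \<in> filled_axis - bipyramid" and G: "G \<in> filled_axis - bipyramid" and "F \<subseteq> G" for F G
  proof -
    have fin: "finite (mids G)" using shapes[OF G] by auto
    have sub: "mids F \<subseteq> mids G" using \<open>F \<subseteq> G\<close> by (rule mids_mono)
    have "first_mid G \<le> first_mid F"
    proof (cases "mids F = {}")
      case True
      then show ?thesis using le[OF G] by (simp add: first_mid_simps)
    next
      case False
      then show ?thesis
        using Min_antimono[OF sub False fin] sub by (auto simp: first_mid_def)
    qed
    then show ?thesis by simp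
  qed
  show "\<exists>v. \<forall>G\<in>filled_axis - bipyramid. n - 1 - first_mid G = n - 1 - first_mid F \<longrightarrow>
      insert v G \<in> filled_axis \<and> G - {v} \<notin> bipyramid \<and> n - 1 - first_mid (insert v G) = n - 1 - first_mid F \<and>
      n - 1 - first_mid (G - {v}) = n - 1 - first_mid F" if F: "F \<in> filled_axis - bipyramid" for F
  proof -
    define k where "k = first_mid F"
    have k: "k \<le> n - 1" using le[OF F] by (simp add: k_def)
    have same: "first_mid G = k" if "G \<in> filled_axis - bipyramid" "n - 1 - first_mid G = n - 1 - k" for G
      using that le[OF that(1)] k by linarith
    have "\<exists>l. \<forall>G\<in>filled_axis - bipyramid. first_mid G = k \<longrightarrow> insert (Mid l) G \<in> filled_axis \<and>
      first_mid (insert (Mid l) G) = k \<and> first_mid (G - {Mid l}) = k"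
    proof (cases "k = n - 1")
      case True
      have "insert (Mid k) G \<in> filled_axis \<and> first_mid (insert (Mid k) G) = k \<and> first_mid (G - {Mid k}) = k"
        if G: "G \<in> filled_axis - bipyramid" and lab: "first_mid G = k" for G
      proof -
        have "mids G = {} \<or> mids G = {k}"
          using shapes[OF G]
        proof (elim disjE exE conjE)
          show ?thesis if "mids G = {j, Suc j}" "Suc j < n" for j
            using first_mid_simps(3)[OF that(1)] lab True that(2) by simp
        qed (use first_mid_simps(2)[of G] lab in auto)
        then have m: "insert k (mids G) = {k}" "mids G - {k} = {}" by auto
        have "insert (Mid k) G \<in> filled_axis"
        proof (rule axis_face[of _ "n - 2"])
          show "mids (insert (Mid k) G) \<subseteq> {n - 2, Suc (n - 2)}"
            using m(1) True n_ge_4 by auto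
        qed (use *[OF G] n_ge_4 in auto)
        then show ?thesis
          using m True first_mid_simps(2)[of "insert (Mid k) G" k]
            first_mid_simps(1)[of "G - {Mid k}"] by simp
      qed
      then show ?thesis by blast
    next
      case False
      then have kn: "Suc k < n" using k by simp
      have "insert (Mid (Suc k)) G \<in> filled_axis \<and> first_mid (insert (Mid (Suc k)) G) = k \<and>
          first_mid (G - {Mid (Suc k)}) = k"
        if G: "G \<in> filled_axis - bipyramid" and lab: "first_mid G = k" for G
      proof -
        have "mids G = {k} \<or> mids G = {k, Suc k}"
          using shapes[OF G] first_mid_simps[of G] lab False by metis
        then have "insert (Suc k) (mids G) = {k, Suc k}" "mids G - {Suc k} = {k}" by auto
        then show ?thesis
          using axis_face[of "insert (Mid (Suc k)) G" k] *[OF G] kn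
            first_mid_simps(3)[of "insert (Mid (Suc k)) G" k]
            first_mid_simps(2)[of "G - {Mid (Suc k)}" k] by simp
      qed
      then show ?thesis by blast
    qed
    then obtain l where l: "\<And>G. G \<in> filled_axis - bipyramid \<Longrightarrow> first_mid G = k \<Longrightarrow> insert (Mid l) G \<in> filled_axis \<and>
      first_mid (insert (Mid l) G) = k \<and> first_mid (G - {Mid l}) = k" by blast
    show ?thesis
    proof (intro exI[of _ "Mid l"] ballI impI)
      fix G assume G: "G \<in> filled_axis - bipyramid" and "n - 1 - first_mid G = n - 1 - first_mid F"
      then have "first_mid G = k" using same by (simp add: k_def)
      moreover have "G - {Mid l} \<notin> bipyramid" using *(1,2)[OF G] by (intro not_6) auto
      ultimately show "insert (Mid l) G \<in> filled_axis \<and> G - {Mid l} \<notin> bipyramid \<and>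
          n - 1 - first_mid (insert (Mid l) G) = n - 1 - first_mid F \<and>
          n - 1 - first_mid (G - {Mid l}) = n - 1 - first_mid F"
        using l[OF G] by (simp add: k_def)
    qed
  qed
  show "bipyramid \<subseteq> filled_axis" by (auto simp: bipyramid_def filled_axis_def)
qed (simp_all add: finite_bipyramid finite_filled_axis faces_empty)

text \<open>A removed face has a \<open>Mid\<close> node that is not an end of the path. Its
  \<open>Mid\<close> part then lies on the path, so \<open>Top\<close> can be added even in the
  presence of \<open>Bot\<close>. The edge from \<open>n - 1\<close> to \<open>0\<close> closes the
  circle but not the path; over it the solid tetrahedron is missing, and its boundary
  survives.\<close>

lemma filled_axis_with_tetrahedron:
  "geometric_realization filled_axis homotopy_equivalent_space
     geometric_realization with_tetrahedron"
proof (rule homotopy_equivalent_cone_collapse[where v = Top])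
  have tet: "F \<subset> tetrahedron \<longleftrightarrow> evens F = {} \<and> odds F = {} \<and> mids F \<subseteq> {0, n - 1} \<and>
      \<not> (Top \<in> F \<and> Bot \<in> F \<and> mids F = {0, n - 1})" for F
  proof -
    have sub: "F \<subseteq> tetrahedron \<longleftrightarrow> evens F = {} \<and> odds F = {} \<and> mids F \<subseteq> {0, n - 1}"
    proof
      show "F \<subseteq> tetrahedron" if "evens F = {} \<and> odds F = {} \<and> mids F \<subseteq> {0, n - 1}"
      proof
        show "v \<in> tetrahedron" if "v \<in> F" for v
          using that \<open>evens F = {} \<and> odds F = {} \<and> mids F \<subseteq> {0, n - 1}\<close>
          by (cases v) (auto simp: tetrahedron_def evens_def odds_def mids_def)
      qed
    qed (auto simp: tetrahedron_def evens_def odds_def mids_def)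
    have "tetrahedron \<subseteq> F \<longleftrightarrow> Top \<in> F \<and> Bot \<in> F \<and> {0, n - 1} \<subseteq> mids F"
      by (auto simp: tetrahedron_def mids_def)
    then show ?thesis unfolding psubset_eq sub set_eq_subset[of F] by auto
  qed
  \<comment> \<open>The indices \<open>n - 1\<close> and \<open>0\<close> are consecutive on the
    circle.\<close>
  have wrap: "thin F" if "evens F = {}" "odds F = {}" "mids F \<subseteq> {0, n - 1}" for F
    using that arc_1[of "n - 1"] n_ge_4 by (intro thinI[of "n - 1" 1]) (auto simp: succ_def)
  have with_tetrahedron_iff: "F \<in> with_tetrahedron \<longleftrightarrow> F \<in> filled_axis \<and> mids F \<subseteq> {0, n - 1}" for F
  proof
    assume "F \<in> with_tetrahedron"
    then consider "even_cap F" | "odd_cap F" | "F \<subset> tetrahedron" by (auto simp: with_tetrahedron_def)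
    then show "F \<in> filled_axis \<and> mids F \<subseteq> {0, n - 1}"
    proof cases
      case 3
      then have F: "evens F = {}" "odds F = {}" "mids F \<subseteq> {0, n - 1}"
        and "\<not> (Top \<in> F \<and> Bot \<in> F \<and> mids F = {0, n - 1})" using tet by auto
      then have "{Top, Bot} \<subseteq> F \<Longrightarrow> mids F \<subseteq> {0, Suc 0} \<or> mids F \<subseteq> {n - 2, Suc (n - 2)}"
        using n_ge_4 by (auto simp: subset_iff)
      moreover have "Suc 0 < n" "Suc (n - 2) < n" using n_ge_4 by auto
      ultimately show ?thesis using F wrap[OF F] unfolding filled_axis_def by blast
    qed (auto simp: filled_axis_def even_cap_def odd_cap_def)
  next
    assume F: "F \<in> filled_axis \<and> mids F \<subseteq> {0, n - 1}"
    have "\<not> {0, n - 1} \<subseteq> {k, Suc k}" if "Suc k < n" for k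
      using n_ge_4 that by auto
    then show "F \<in> with_tetrahedron"
      using F n_ge_4 unfolding with_tetrahedron_def filled_axis_def tet mem_Collect_eq by auto
  qed
  show "insert Top F \<in> filled_axis" if F: "F \<in> filled_axis - with_tetrahedron" for F
  proof (cases "Bot \<in> F")
    case False
    then show ?thesis
      using F by (auto simp: with_tetrahedron_iff) (auto simp: filled_axis_def even_cap_def odd_cap_def)
  next
    case True
    have m: "\<not> mids F \<subseteq> {0, n - 1}" using F by (auto simp: with_tetrahedron_iff)
    then have F': "evens F = {}" "odds F = {}" "thin F \<or> (\<exists>k. Suc k < n \<and> mids F \<subseteq> {k, Suc k})"
      using F by (auto simp: filled_axis_def even_cap_def odd_cap_def)
    have "\<exists>k. Suc k < n \<and> mids F \<subseteq> {k, Suc k}" if thin: "thin F"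
      using thin
    proof (cases rule: thin_mids_cases)
      case (2 k)
      then show ?thesis using m by (intro exI[of _ "k - 1"]) auto
    next
      case (3 k)
      then show ?thesis using m by (intro exI[of _ k]) (auto simp: succ_def split: if_splits)
    qed (use m in auto)
    then show ?thesis using F' by (auto simp: filled_axis_def)
  qed
  show "F - {Top} \<notin> with_tetrahedron" if "F \<in> filled_axis - with_tetrahedron" for F
    using that finite_complex_mono[OF finite_filled_axis, of F "F - {Top}"] by (auto simp: with_tetrahedron_iff)
  show "with_tetrahedron \<subseteq> filled_axis" by (auto simp: with_tetrahedron_iff)
qed (auto simp: finite_filled_axis finite_with_tetrahedron faces_empty)

text \<open>The additional faces contain \<open>Top\<close> and an odd node, and they are free to
  contain \<open>Bot\<close>. This and the collapse towards \<open>Top\<close> below move the odd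
  sphere along the edge from \<open>Bot\<close> to \<open>Top\<close>.\<close>

lemma joined_poles_with_tetrahedron:
  "geometric_realization joined_poles homotopy_equivalent_space
     geometric_realization with_tetrahedron"
proof (rule homotopy_equivalent_cone_collapse[where v = Bot])
  have *: "Top \<in> F \<and> odds F \<noteq> {} \<and> evens F = {} \<and> mids F = {} \<and> odds F \<subset> {0<..<n}"
    if "F \<in> joined_poles - with_tetrahedron" for F
  proof -
    have F: "evens F = {}" "mids F = {}" "odds F \<subset> {0<..<n}" "\<not> odd_cap F" "\<not> F \<subset> tetrahedron"
      using that by (auto simp: with_tetrahedron_def joined_poles_def)
    have "odds F \<subseteq> {0<..<n}" using F(3) by blast
    then have "Top \<in> F" using F(1-4) by (simp add: odd_cap_def split: if_splits)
    moreover have "odds F \<noteq> {}"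
    proof
      assume "odds F = {}"
      then have "F \<subseteq> {Top, Bot}"
        using F(1,2) by (auto simp: evens_def odds_def mids_def) (metis node.exhaust)
      then show False using F(5) by (auto simp: tetrahedron_def)
    qed
    ultimately show ?thesis using F by simp
  qed
  show "insert Bot F \<in> joined_poles" if "F \<in> joined_poles - with_tetrahedron" for F
    using *[OF that] by (simp add: joined_poles_def)
  show "F - {Bot} \<notin> with_tetrahedron" if "F \<in> joined_poles - with_tetrahedron" for F
  proof -
    have "odds (F - {Bot}) \<noteq> {}" "Top \<in> F - {Bot}" using *[OF that] by auto
    moreover have "odds tetrahedron = {}" by (auto simp: tetrahedron_def odds_def)
    ultimately show ?thesis
      using odds_mono[of "F - {Bot}" tetrahedron] by (auto simp: with_tetrahedron_def even_cap_def odd_cap_def)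
  qed
qed (auto simp: with_tetrahedron_def joined_poles_def
    finite_with_tetrahedron[unfolded with_tetrahedron_def]
    finite_joined_poles[unfolded joined_poles_def]
    faces_empty(8)[unfolded with_tetrahedron_def, simplified])

lemma simplex_wedge_iff: "F \<in> simplex_wedge \<longleftrightarrow> F \<in> joined_poles \<and> (Bot \<notin> F \<or> odds F = {})"
proof -
  have tet: "odds F = {}" if "F \<subset> tetrahedron"
    using that by (auto simp: tetrahedron_def odds_def)
  have small: "F \<subset> tetrahedron" if "evens F = {}" "odds F = {}" "mids F = {}"
  proof -
    have "F \<subseteq> {Top, Bot}"
      using that by (auto simp: evens_def odds_def mids_def) (metis node.exhaust)
    then show ?thesis by (auto simp: tetrahedron_def)
  qed
  have "even_cap F \<Longrightarrow> Bot \<notin> F" by (simp add: even_cap_def)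
  moreover have "odds F \<subset> {0<..<n} \<Longrightarrow> odds F \<subseteq> {0<..<n}" by (rule psubset_imp_subset)
  ultimately show ?thesis
    using tet small unfolding simplex_wedge_def joined_poles_def odd_cap_def mem_Collect_eq
    by (smt (verit))
qed

text \<open>Now the faces that contain \<open>Bot\<close> and an odd node are removed; the facet of
  all odd nodes except \<open>Odd 0\<close> contains neither pole and stays in place.\<close>

lemma joined_poles_simplex_wedge:
  "geometric_realization joined_poles homotopy_equivalent_space
     geometric_realization simplex_wedge"
proof (rule homotopy_equivalent_cone_collapse[where v = Top])
  have "odds F = {}" if "F \<subset> tetrahedron" for F
    using that by (auto simp: tetrahedron_def odds_def)
  then show "insert Top F \<in> joined_poles" if "F \<in> joined_poles - simplex_wedge" for F
    using that by (auto simp: simplex_wedge_iff) (auto simp: joined_poles_def even_cap_def odd_cap_def)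
  show "F - {Top} \<notin> simplex_wedge" if "F \<in> joined_poles - simplex_wedge" for F
    using that by (auto simp: simplex_wedge_iff)
qed (auto simp: simplex_wedge_iff finite_joined_poles finite_simplex_wedge faces_empty)

definition wedge_node :: "nat \<Rightarrow> nat \<Rightarrow> node" where
  "wedge_node i k = (if k = 0 then Top else if i = 0 then [Top, Bot, Mid 0, Mid (n - 1)] ! k
     else if i = 1 then Even k else Odd k)"

lemma simplex_wedge_wedge:
  "wedge_of_spheres [2, n - 2, n - 2] homeomorphic_space geometric_realization simplex_wedge"
proof -
  let ?ds = "[2, n - 2, n - 2]"
  have i: "i < length ?ds \<longleftrightarrow> i = 0 \<or> i = 1 \<or> i = 2" for i by auto
  have n2: "Suc (n - 2) = n - 1" using n_ge_4 by simp
  have img0: "wedge_node 0 ` {..Suc 2} = tetrahedron"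
  proof -
    have "{..Suc 2} = {0, 1, 2, 3 :: nat}" by auto
    then show ?thesis by (auto simp: wedge_node_def tetrahedron_def)
  qed
  have img: "wedge_node 1 ` {..n - 1} = insert Top (Even ` {0<..<n})"
    "wedge_node 2 ` {..n - 1} = insert Top (Odd ` {0<..<n})"
  proof -
    have "{..n - 1} = insert 0 {0<..<n}" using n_ge_4 by auto
    then show "wedge_node 1 ` {..n - 1} = insert Top (Even ` {0<..<n})"
      "wedge_node 2 ` {..n - 1} = insert Top (Odd ` {0<..<n})"
      by (auto simp: wedge_node_def image_iff)
  qed
  have even: "F \<subset> insert Top (Even ` {0<..<n}) \<longleftrightarrow> even_cap F" for F
  proof -
    have "F \<subseteq> insert Top (Even ` {0<..<n}) \<longleftrightarrow> Bot \<notin> F \<and> mids F = {} \<and> odds F = {} \<and> evens F \<subseteq> {0<..<n}"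
      (is "_ \<longleftrightarrow> ?r")
    proof
      show "F \<subseteq> insert Top (Even ` {0<..<n})" if ?r
      proof
        show "v \<in> insert Top (Even ` {0<..<n})" if "v \<in> F" for v
          using that \<open>?r\<close> by (cases v) (auto simp: evens_def odds_def mids_def)
      qed
    qed (auto simp: evens_def odds_def mids_def)
    moreover have "insert Top (Even ` {0<..<n}) \<subseteq> F \<longleftrightarrow> Top \<in> F \<and> {0<..<n} \<subseteq> evens F"
      by (auto simp: evens_def)
    ultimately show ?thesis
      unfolding even_cap_def by auto
  qed
  have odd: "F \<subset> insert Top (Odd ` {0<..<n}) \<longleftrightarrow> Bot \<notin> F \<and> evens F = {} \<and> mids F = {} \<and>
       (if Top \<in> F then odds F \<subset> {0<..<n} else odds F \<subseteq> {0<..<n})" for F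
  proof -
    have "F \<subseteq> insert Top (Odd ` {0<..<n}) \<longleftrightarrow> Bot \<notin> F \<and> mids F = {} \<and> evens F = {} \<and> odds F \<subseteq> {0<..<n}"
      (is "_ \<longleftrightarrow> ?r")
    proof
      show "F \<subseteq> insert Top (Odd ` {0<..<n})" if ?r
      proof
        show "v \<in> insert Top (Odd ` {0<..<n})" if "v \<in> F" for v
          using that \<open>?r\<close> by (cases v) (auto simp: evens_def odds_def mids_def)
      qed
    qed (auto simp: evens_def odds_def mids_def)
    moreover have "insert Top (Odd ` {0<..<n}) \<subseteq> F \<longleftrightarrow> Top \<in> F \<and> {0<..<n} \<subseteq> odds F"
      by (auto simp: odds_def)
    ultimately show ?thesis by auto
  qed
  have simplex_wedge: "simplex_wedge = {F. \<exists>i<length ?ds. F \<subset> wedge_node i ` {..Suc (?ds ! i)}}"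
  proof -
    have "(\<exists>i<length ?ds. F \<subset> wedge_node i ` {..Suc (?ds ! i)}) \<longleftrightarrow>
        F \<subset> wedge_node 0 ` {..Suc 2} \<or> F \<subset> wedge_node 1 ` {..Suc (n - 2)} \<or>
        F \<subset> wedge_node 2 ` {..Suc (n - 2)}" for F
      unfolding i by (simp add: ex_disj_distrib conj_disj_distribR)
    then show ?thesis
      unfolding n2 img0 img even odd simplex_wedge_def by (simp only: disj_left_commute)
  qed
  show ?thesis
    unfolding simplex_wedge
  proof (rule wedge_of_spheres_homeomorphic_realization)
    show "wedge_node i 0 = Top" for i by (simp add: wedge_node_def)
    fix i k i' k'
    assume *: "i < length ?ds" "i' < length ?ds" "k \<le> Suc (?ds ! i)" "k' \<le> Suc (?ds ! i')"
      "wedge_node i k = wedge_node i' k'"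
    have small: "k = 0 \<or> k = 1 \<or> k = 2 \<or> k = 3" if "k \<le> Suc 2" for k :: nat
      using that by auto
    show "(i = i' \<or> k = 0) \<and> k = k'"
    proof (cases "i = 0")
      case True
      then have "k \<le> Suc 2" using * by simp
      then have "k = 0 \<or> k = 1 \<or> k = 2 \<or> k = 3" by (rule small)
      moreover have "k' = 0 \<or> k' = 1 \<or> k' = 2 \<or> k' = 3" if "i' = 0"
        using * that by (intro small) simp
      ultimately show ?thesis
        using *(5) True n_ge_4 by (auto simp: wedge_node_def split: if_splits)
    next
      case False
      moreover have "k' = 0 \<or> k' = 1 \<or> k' = 2 \<or> k' = 3" if "i' = 0"
        using * that by (intro small) simp
      ultimately show ?thesis
        using * by (auto simp: wedge_node_def i split: if_splits)
    qed
  qed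
qed

lemma arc_complex_wedge:
  "geometric_realization (arc_complex ({..<n} \<times> {..n - 3})) homotopy_equivalent_space
     wedge_of_spheres [2, n - 2, n - 2]"
proof -
  note arc_complex_short_arcs
  also have "geometric_realization (arc_complex ({..<n} \<times> {..1})) homotopy_equivalent_space
      geometric_realization with_equator"
    by (subst homotopy_equivalent_space_sym) (rule with_equator_arc_complex)
  also note with_equator_two_sided
  also have "geometric_realization two_sided homotopy_equivalent_space geometric_realization even_coned"
    by (subst homotopy_equivalent_space_sym) (rule even_coned_two_sided)
  also note even_coned_even_capped
  also have "geometric_realization even_capped homotopy_equivalent_space geometric_realization odd_coned"
    by (subst homotopy_equivalent_space_sym) (rule odd_coned_even_capped)
  also note odd_coned_bipyramid
  also have "geometric_realization bipyramid homotopy_equivalent_space geometric_realization filled_axis"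
    by (subst homotopy_equivalent_space_sym) (rule filled_axis_bipyramid)
  also note filled_axis_with_tetrahedron
  also have "geometric_realization with_tetrahedron homotopy_equivalent_space geometric_realization joined_poles"
    by (subst homotopy_equivalent_space_sym) (rule joined_poles_with_tetrahedron)
  also note joined_poles_simplex_wedge
  also have "geometric_realization simplex_wedge homotopy_equivalent_space wedge_of_spheres [2, n - 2, n - 2]"
    by (subst homotopy_equivalent_space_sym)
      (rule homeomorphic_imp_homotopy_equivalent_space[OF simplex_wedge_wedge])
  finally show ?thesis .
qed

subsection \<open>The Morse complex of a cycle\<close>

lemma circle_induct:
  assumes "j < n" "P j" and step: "\<And>i. i < n \<Longrightarrow> P i \<Longrightarrow> P (succ i)" and "i < n"
  shows "P i"
  using \<open>i < n\<close>
proof (induction "shift j i" arbitrary: i)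
  case 0
  then have "i = j" using assms(1) by (auto simp: shift_def split: if_splits)
  then show ?case using assms(2) by simp
next
  case (Suc d)
  let ?p = "if i = 0 then n - 1 else i - 1"
  have p: "?p < n" "succ ?p = i" using Suc.prems by (auto simp: succ_def)
  have "shift j ?p = d"
    using Suc.hyps(2) Suc.prems assms(1) by (auto simp: shift_def split: if_splits)
  then have "P (succ ?p)" using Suc.hyps(1) p(1) step by blast
  then show ?case using p(2) by simp
qed

text \<open>By contraposition: the negation of \<open>P\<close> is carried forward from
  \<open>i\<close> to \<open>j\<close>.\<close>

lemma circle_induct_back:
  assumes "j < n" "P j" and step: "\<And>i. i < n \<Longrightarrow> P (succ i) \<Longrightarrow> P i" and "i < n"
  shows "P i"
proof (rule ccontr)
  assume "\<not> P i"
  then have "\<not> P j"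
    using circle_induct[of i "\<lambda>k. \<not> P k" j] assms by blast
  then show False using assms(2) by simp
qed

lemma succ_inj: "i < n \<Longrightarrow> j < n \<Longrightarrow> succ i = succ j \<longleftrightarrow> i = j"
  by (auto simp: succ_def)

lemma succ_neq: "i < n \<Longrightarrow> succ i \<noteq> i"
  using n_ge_4 by (auto simp: succ_def)

lemma Suc_mod_eq_succ: "i < n \<Longrightarrow> Suc i mod n = succ i"
  by (auto simp: succ_def)

section \<open>The Hasse diagram of the cycle\<close>

definition side :: "nat \<Rightarrow> nat set" where
  "side i = {i, succ i}"

lemma side_inj: "i < n \<Longrightarrow> j < n \<Longrightarrow> side i = side j \<longleftrightarrow> i = j"
  using n_ge_4 by (auto simp: side_def succ_def doubleton_eq_iff)

lemma side_neq: "i < n \<Longrightarrow> side i \<noteq> {k}" "i < n \<Longrightarrow> {k} \<noteq> side i"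
  using succ_neq by (auto simp: side_def)

lemma vertex_psubset_side: "i < n \<Longrightarrow> {k} \<subset> side i \<longleftrightarrow> k = i \<or> k = succ i"
  using succ_neq[of i] by (auto simp: side_def)

lemma not_side_psubset: "i < n \<Longrightarrow> \<not> side i \<subset> {k}"
  using succ_neq[of i] by (auto simp: side_def)

lemma cycle_complex_faces: "cycle_complex n = {{}} \<union> (\<lambda>i. {i}) ` {..<n} \<union> side ` {..<n}"
proof -
  have "{{i} |i. i < n} = (\<lambda>i. {i}) ` {..<n}" by auto
  moreover have "{{i, Suc i mod n} |i. i < n} = side ` {..<n}"
    unfolding setcompr_eq_image by (intro image_cong) (auto simp: side_def Suc_mod_eq_succ)
  ultimately show ?thesis unfolding cycle_complex_def by simp
qed

text \<open>The nodes \<open>Mid i\<close>, \<open>Top\<close> and \<open>Bot\<close> stand for no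
  edge and get a dummy value; injectivity holds on \<open>coloured\<close>.\<close>

primrec hasse_edge :: "node \<Rightarrow> nat set set" where
  "hasse_edge (Even i) = {{i}, side i}"
| "hasse_edge (Odd i) = {{succ i}, side i}"
| "hasse_edge (Mid i) = {}"
| "hasse_edge Top = {}"
| "hasse_edge Bot = {}"

definition coloured :: "node set" where
  "coloured = Even ` {..<n} \<union> Odd ` {..<n}"

lemma hasse_edges_cycle: "hasse_edges (cycle_complex n) = hasse_edge ` coloured"
proof
  show "hasse_edges (cycle_complex n) \<subseteq> hasse_edge ` coloured"
  proof
    fix e assume "e \<in> hasse_edges (cycle_complex n)"
    then obtain f g where fg: "e = {f, g}" "f \<in> cycle_complex n" "g \<in> cycle_complex n" "f \<noteq> {}"
      "f \<subset> g" "card g = Suc (card f)"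
      unfolding hasse_edges_def by blast
    have card: "card (side i) = 2" if "i < n" for i
      using succ_neq[OF that] by (simp add: side_def)
    have faces: "h = {} \<or> (\<exists>k<n. h = {k}) \<or> (\<exists>i<n. h = side i)" if "h \<in> cycle_complex n" for h
      using that unfolding cycle_complex_faces by blast
    have "card g \<le> 2"
      using faces[OF fg(3)] card by fastforce
    then have "card f \<le> 1" using fg(6) by simp
    then obtain k where k: "k < n" "f = {k}"
      using faces[OF fg(2)] fg(4) card by fastforce
    then have "card g = 2" using fg(6) by simp
    then obtain i where i: "i < n" "g = side i"
      using faces[OF fg(3)] by fastforce
    then have "k = i \<or> k = succ i"
      using fg(5) k vertex_psubset_side by blast
    then have "e = hasse_edge (Even i) \<or> e = hasse_edge (Odd i)"
      using fg(1) k(2) i(2) by auto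
    then show "e \<in> hasse_edge ` coloured"
      using i(1) unfolding coloured_def by blast
  qed
  show "hasse_edge ` coloured \<subseteq> hasse_edges (cycle_complex n)"
  proof
    fix e assume "e \<in> hasse_edge ` coloured"
    then obtain k i where ki: "i < n" "e = {{k}, side i}" "k = i \<or> k = succ i"
      by (auto simp: coloured_def)
    moreover have "card (side i) = Suc (card {k})"
      using succ_neq[OF ki(1)] by (simp add: side_def)
    moreover have "k < n" using ki succ_less by auto
    then have "{k} \<in> cycle_complex n" "side i \<in> cycle_complex n"
      using ki(1) unfolding cycle_complex_faces by blast+
    moreover have "{k} \<subset> side i" using vertex_psubset_side[OF ki(1)] ki(3) by blast
    ultimately show "e \<in> hasse_edges (cycle_complex n)"
      unfolding hasse_edges_def by blast
  qed
qed

lemma hasse_edge_disjnt: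
  assumes "i < n" "j < n"
  shows "disjnt (hasse_edge (Even i)) (hasse_edge (Even j)) \<longleftrightarrow> i \<noteq> j"
    "disjnt (hasse_edge (Odd i)) (hasse_edge (Odd j)) \<longleftrightarrow> i \<noteq> j"
    "disjnt (hasse_edge (Even i)) (hasse_edge (Odd j)) \<longleftrightarrow> i \<noteq> j \<and> i \<noteq> succ j"
    "disjnt (hasse_edge (Odd j)) (hasse_edge (Even i)) \<longleftrightarrow> i \<noteq> j \<and> i \<noteq> succ j"
  using assms side_inj side_neq succ_inj by (auto simp: disjnt_def)

lemma inj_on_hasse_edge: "inj_on hasse_edge coloured"
proof (rule inj_onI)
  fix u v assume uv: "u \<in> coloured" "v \<in> coloured" "hasse_edge u = hasse_edge v"
  have "\<not> {{i}, side i} = {{succ j}, side j}" if "i < n" "j < n" for i j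
    using that side_inj side_neq succ_neq by (auto simp: doubleton_eq_iff)
  moreover have "{{k}, side i} = {{l}, side j} \<Longrightarrow> i = j" if "i < n" "j < n" for i j k l
    using that side_inj side_neq by (auto simp: doubleton_eq_iff)
  ultimately show "u = v"
    using uv unfolding coloured_def by (auto dest: sym)
qed

text \<open>\<open>Odd j\<close> meets \<open>Even j\<close> in the side \<open>j\<close> and
  \<open>Even (succ j)\<close> in the vertex \<open>succ j\<close>; distinct edges of equal colour
  are disjoint.\<close>

definition independent :: "node set \<Rightarrow> bool" where
  "independent F \<longleftrightarrow> F \<subseteq> coloured \<and> (\<forall>j\<in>odds F. j \<notin> evens F \<and> succ j \<notin> evens F)"

lemma hasse_matching_iff:
  assumes "F \<subseteq> coloured"
  shows "hasse_matching (cycle_complex n) (hasse_edge ` F) \<longleftrightarrow> independent F"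
proof
  assume "hasse_matching (cycle_complex n) (hasse_edge ` F)"
  then have pw: "pairwise disjnt (hasse_edge ` F)"
    by (simp add: hasse_matching_def)
  have disj: "disjnt (hasse_edge u) (hasse_edge v)" if "u \<in> F" "v \<in> F" "u \<noteq> v" for u v
  proof (rule pairwiseD[OF pw])
    show "hasse_edge u \<noteq> hasse_edge v"
      using inj_onD[OF inj_on_hasse_edge] that assms by blast
  qed (use that in auto)
  show "independent F"
    unfolding independent_def
  proof (intro conjI ballI assms)
    fix j assume j: "j \<in> odds F"
    then have "Odd j \<in> F" "j < n" using assms by (auto simp: odds_def coloured_def)
    moreover have "i < n" if "Even i \<in> F" for i
      using that assms by (auto simp: coloured_def)
    ultimately show "j \<notin> evens F" "succ j \<notin> evens F"
      using disj hasse_edge_disjnt(3) unfolding evens_def by blast+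
  qed
next
  assume ind: "independent F"
  have "disjnt (hasse_edge u) (hasse_edge v)" if u: "u \<in> F" and v: "v \<in> F" and "u \<noteq> v" for u v
  proof -
    have col: "u \<in> coloured" "v \<in> coloured" using u v assms by auto
    have c: "i \<noteq> j \<and> i \<noteq> succ j" if "Even i \<in> F" "Odd j \<in> F" for i j
      using ind that by (auto simp: independent_def evens_def odds_def)
    show ?thesis
    proof (cases u)
      case (Even i)
      then show ?thesis
        using col u v c \<open>u \<noteq> v\<close> hasse_edge_disjnt by (cases v) (auto simp: coloured_def simp del: hasse_edge.simps)
    next
      case (Odd i)
      then show ?thesis
        using col u v c \<open>u \<noteq> v\<close> hasse_edge_disjnt by (cases v) (auto simp: coloured_def simp del: hasse_edge.simps)
    qed (use col in \<open>auto simp: coloured_def\<close>)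
  qed
  then have "pairwise disjnt (hasse_edge ` F)"
    unfolding pairwise_def by blast
  then show "hasse_matching (cycle_complex n) (hasse_edge ` F)"
    using assms by (auto simp: hasse_matching_def hasse_edges_cycle)
qed

lemma hasse_edge_mem: "F \<subseteq> coloured \<Longrightarrow> u \<in> coloured \<Longrightarrow> hasse_edge u \<in> hasse_edge ` F \<longleftrightarrow> u \<in> F"
  by (rule inj_on_image_mem_iff[OF inj_on_hasse_edge])

lemma hasse_orientation_cycle:
  assumes "F \<subseteq> coloured"
  shows "(a, b) \<in> hasse_orientation (cycle_complex n) (hasse_edge ` F) \<longleftrightarrow>
    (\<exists>i<n. a = {i} \<and> b = side i \<and> Even i \<in> F \<or> a = {succ i} \<and> b = side i \<and> Odd i \<in> F \<or>
      a = side i \<and> b = {i} \<and> Even i \<notin> F \<or> a = side i \<and> b = {succ i} \<and> Odd i \<notin> F)"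
    (is "?l \<longleftrightarrow> ?r")
proof
  have col: "Even i \<in> coloured" "Odd i \<in> coloured" if "i < n" for i
    using that by (auto simp: coloured_def)
  assume ?l
  then have l: "{a, b} \<in> hasse_edge ` coloured"
      "if {a, b} \<in> hasse_edge ` F then a \<subset> b else b \<subset> a"
    by (simp_all add: hasse_orientation_def hasse_edges_cycle)
  then obtain u where u: "u \<in> coloured" "{a, b} = hasse_edge u" by auto
  then have sub: "if u \<in> F then a \<subset> b else b \<subset> a"
    using l(2) hasse_edge_mem[OF assms u(1)] by simp
  obtain i k where i: "i < n" and k: "u = Even i \<and> k = i \<or> u = Odd i \<and> k = succ i"
    using u(1) by (auto simp: coloured_def)
  then have "{a, b} = {{k}, side i}" using u(2) by auto
  then consider "a = {k}" "b = side i" | "a = side i" "b = {k}"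
    by (auto simp: doubleton_eq_iff)
  then show ?r
  proof cases
    case 1
    then have "u \<in> F" using sub not_side_psubset[OF i] by (metis (full_types))
    then show ?thesis using 1 i k by blast
  next
    case 2
    then have "u \<notin> F" using sub not_side_psubset[OF i] by (metis (full_types))
    then show ?thesis using 2 i k by blast
  qed
next
  have col: "Even i \<in> coloured" "Odd i \<in> coloured" if "i < n" for i
    using that by (auto simp: coloured_def)
  assume ?r
  then obtain i where i: "i < n" and
    "a = {i} \<and> b = side i \<and> Even i \<in> F \<or> a = {succ i} \<and> b = side i \<and> Odd i \<in> F \<or>
      a = side i \<and> b = {i} \<and> Even i \<notin> F \<or> a = side i \<and> b = {succ i} \<and> Odd i \<notin> F" by blast
  then obtain k u where k: "u = Even i \<and> k = i \<or> u = Odd i \<and> k = succ i" and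
    ab: "u \<in> F \<and> a = {k} \<and> b = side i \<or> u \<notin> F \<and> a = side i \<and> b = {k}"
    by metis
  have "hasse_edge u = {{k}, side i}" using k by auto
  then have "{a, b} = hasse_edge u" using ab by (auto simp: insert_commute)
  moreover have "u \<in> coloured" using k col[OF i] by blast
  moreover have "{k} \<subset> side i" using k vertex_psubset_side[OF i] by blast
  then have "if u \<in> F then a \<subset> b else b \<subset> a"
    using ab by auto
  ultimately show ?l
    using hasse_edge_mem[OF assms] by (auto simp: hasse_orientation_def hasse_edges_cycle)
qed

text \<open>
  A directed cycle leaves every node \<open>{i}\<close> along an edge of the matching and must therefore run
  around the whole diagram.
\<close>

lemma acyclic_hasse_orientation_iff:
  assumes ind: "independent F"
  shows "acyclic (hasse_orientation (cycle_complex n) (hasse_edge ` F)) \<longleftrightarrow>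
    evens F \<noteq> {..<n} \<and> odds F \<noteq> {..<n}" (is "acyclic ?r \<longleftrightarrow> _")
proof -
  have col: "F \<subseteq> coloured" using ind by (simp add: independent_def)
  note r = hasse_orientation_cycle[OF col]
  have sub: "evens F \<subseteq> {..<n}" "odds F \<subseteq> {..<n}"
    using col by (auto simp: evens_def odds_def coloured_def)
  have c: False if "Even i \<in> F" "Odd i \<in> F" for i
    using ind that by (auto simp: independent_def evens_def odds_def)
  have "evens F = {..<n} \<or> odds F = {..<n}" if cyclic: "\<not> acyclic ?r"
  proof -
    obtain x where x: "(x, x) \<in> ?r\<^sup>+"
      using cyclic unfolding acyclic_def by blast
    \<comment> \<open>The faces from which \<open>x\<close> can be reached. Since \<open>x\<close>
      reaches itself, every member of \<open>S\<close> has a successor in \<open>S\<close>, so a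
      walk inside \<open>S\<close> never ends.\<close>
    define S where "S = {y. (y, x) \<in> ?r\<^sup>+}"
    have S: "\<exists>z\<in>S. (y, z) \<in> ?r" if y: "y \<in> S" for y
    proof -
      obtain z where z: "(y, z) \<in> ?r" "(z, x) \<in> ?r\<^sup>*"
        using y tranclD unfolding S_def by fast
      then have "z \<in> S" using x unfolding S_def by (auto simp: rtrancl_eq_or_trancl)
      then show ?thesis using z by blast
    qed
    have vertex: "Even i \<in> F \<and> side i \<in> S \<or> (\<exists>j<n. i = succ j \<and> Odd j \<in> F \<and> side j \<in> S)"
      if "{i} \<in> S" for i
      using S[OF that] side_neq unfolding r by auto
    have side: "Even i \<notin> F \<and> {i} \<in> S \<or> Odd i \<notin> F \<and> {succ i} \<in> S" if i: "i < n" "side i \<in> S" for i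
    proof -
      obtain z where z: "z \<in> S" "(side i, z) \<in> ?r" using S[OF i(2)] by blast
      then show ?thesis using i(1) side_neq side_inj unfolding r by auto
    qed
    have "x \<in> S" using x by (simp add: S_def)
    then obtain z where "z \<in> S" "(x, z) \<in> ?r" using S by blast
    then obtain i where i: "i < n" "side i \<in> S"
      using \<open>x \<in> S\<close> unfolding r by auto
    \<comment> \<open>The walk cannot leave \<open>{succ i}\<close> along \<open>Odd i\<close>,
      which shares the side \<open>i\<close> with \<open>Even i\<close>; so it continues along
      \<open>Even (succ i)\<close>.\<close>
    have even: "{succ i} \<in> S \<and> Even (succ i) \<in> F" if "i < n" "{i} \<in> S" "Even i \<in> F" for i
    proof -
      have "side i \<in> S"
        using vertex[OF that(2)] that c ind by (auto simp: independent_def evens_def odds_def)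
      then have s: "{succ i} \<in> S" using side[OF that(1)] that(3) by blast
      then show ?thesis
        using vertex[OF s] that(1,3) succ_inj c by blast
    qed
    have odd: "{j} \<in> S \<and> (\<exists>k<n. succ k = j \<and> Odd k \<in> F)" if "j < n" "{succ j} \<in> S" "Odd j \<in> F" for j
    proof -
      have "Even (succ j) \<notin> F"
        using ind that(3) by (auto simp: independent_def evens_def odds_def)
      then have "side j \<in> S"
        using vertex[OF that(2)] succ_inj[OF that(1)] by blast
      then have s: "{j} \<in> S" using side[OF that(1)] that(3) by blast
      then show ?thesis
        using vertex[OF s] that(1,3) c by blast
    qed
    obtain k where "{k} \<in> S" using side[OF i] by blast
    from vertex[OF this] show ?thesis
    proof
      assume k: "Even k \<in> F \<and> side k \<in> S"
      then have "k < n" using sub by (auto simp: evens_def)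
      then have "{i} \<in> S \<and> Even i \<in> F" if "i < n" for i
        using circle_induct[of k "\<lambda>i. {i} \<in> S \<and> Even i \<in> F" i] k \<open>{k} \<in> S\<close> that even by blast
      then have "evens F = {..<n}" using sub by (auto simp: evens_def)
      then show ?thesis ..
    next
      assume "\<exists>j<n. k = succ j \<and> Odd j \<in> F \<and> side j \<in> S"
      then obtain j where j: "j < n" "k = succ j" "Odd j \<in> F" by blast
      have "{succ i} \<in> S \<and> Odd i \<in> F" if "i < n" for i
      proof (rule circle_induct_back[of j "\<lambda>i. {succ i} \<in> S \<and> Odd i \<in> F" i])
        fix i assume i: "i < n" "{succ (succ i)} \<in> S \<and> Odd (succ i) \<in> F"
        then have "{succ i} \<in> S" "\<exists>k<n. succ k = succ i \<and> Odd k \<in> F"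
          using odd[of "succ i"] succ_less by blast+
        then show "{succ i} \<in> S \<and> Odd i \<in> F" using i(1) succ_inj by blast
      qed (use j \<open>{k} \<in> S\<close> that in auto)
      then have "odds F = {..<n}" using sub by (auto simp: odds_def)
      then show ?thesis ..
    qed
  qed
  moreover have "\<not> acyclic ?r" if "evens F = {..<n}"
  proof -
    have n1: "n - 1 < n" "n - 1 \<noteq> 0" using n_ge_4 by auto
    have step: "({i}, {succ i}) \<in> ?r\<^sup>+" if "i < n" for i
    proof (rule trancl_into_trancl[OF r_into_trancl])
      have E: "Even i \<in> F" using that \<open>evens F = {..<n}\<close> by (auto simp: evens_def)
      then show "({i}, side i) \<in> ?r" using that unfolding r by blast
      show "(side i, {succ i}) \<in> ?r" using that c[OF E] unfolding r by blast
    qed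
    \<comment> \<open>The disjunct \<open>i = 0\<close> starts the induction, as the transitive
      closure is not reflexive.\<close>
    have reach: "({0}, {i}) \<in> ?r\<^sup>+ \<or> i = 0" if i: "i < n" for i
    proof (rule circle_induct[of 0 "\<lambda>i. ({0}, {i}) \<in> ?r\<^sup>+ \<or> i = 0" i])
      show "0 < n" using n_ge_4 by simp
      fix i assume i: "i < n" and IH: "({0}, {i}) \<in> ?r\<^sup>+ \<or> i = 0"
      show "({0}, {succ i}) \<in> ?r\<^sup>+ \<or> succ i = 0"
        using IH
      proof
        assume "({0}, {i}) \<in> ?r\<^sup>+"
        then show ?thesis using step[OF i] by (blast intro: trancl_trans)
      next
        assume "i = 0"
        then show ?thesis using step[OF i] by blast
      qed
    qed (use i in auto)
    from reach[OF n1(1)] have "({0}, {n - 1}) \<in> ?r\<^sup>+" using n1(2) by (simp only: simp_thms)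
    moreover have "({n - 1}, {0}) \<in> ?r\<^sup>+"
      using step[of "n - 1"] n_ge_4 by (simp add: succ_def)
    ultimately have "({0}, {0}) \<in> ?r\<^sup>+" by (rule trancl_trans)
    then show ?thesis unfolding acyclic_def by blast
  qed
  moreover have "\<not> acyclic ?r" if "odds F = {..<n}"
  proof -
    have n1: "n - 1 < n" "n - 1 \<noteq> 0" using n_ge_4 by auto
    have step: "({succ i}, {i}) \<in> ?r\<^sup>+" if "i < n" for i
    proof (rule trancl_into_trancl[OF r_into_trancl])
      have O: "Odd i \<in> F" using that \<open>odds F = {..<n}\<close> by (auto simp: odds_def)
      then show "({succ i}, side i) \<in> ?r" using that unfolding r by blast
      show "(side i, {i}) \<in> ?r" using that c[OF _ O] unfolding r by blast
    qed
    have reach: "({i}, {0}) \<in> ?r\<^sup>+ \<or> i = 0" if i: "i < n" for i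
    proof (rule circle_induct[of 0 "\<lambda>i. ({i}, {0}) \<in> ?r\<^sup>+ \<or> i = 0" i])
      show "0 < n" using n_ge_4 by simp
      fix i assume i: "i < n" and IH: "({i}, {0}) \<in> ?r\<^sup>+ \<or> i = 0"
      show "({succ i}, {0}) \<in> ?r\<^sup>+ \<or> succ i = 0"
        using IH
      proof
        assume "({i}, {0}) \<in> ?r\<^sup>+"
        then show ?thesis using step[OF i] by (blast intro: trancl_trans)
      next
        assume "i = 0"
        then show ?thesis using step[OF i] by blast
      qed
    qed (use i in auto)
    from reach[OF n1(1)] have "({n - 1}, {0}) \<in> ?r\<^sup>+" using n1(2) by (simp only: simp_thms)
    moreover have "({0}, {n - 1}) \<in> ?r\<^sup>+"
      using step[of "n - 1"] n_ge_4 by (simp add: succ_def)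
    ultimately have "({0}, {0}) \<in> ?r\<^sup>+" by (rule trancl_trans[rotated])
    then show ?thesis unfolding acyclic_def by blast
  qed
  ultimately show ?thesis by blast
qed

section \<open>Facets of maximal size\<close>

definition admissible :: "node set \<Rightarrow> bool" where
  "admissible F \<longleftrightarrow> independent F \<and> evens F \<noteq> {..<n} \<and> odds F \<noteq> {..<n}"

lemma morse_complex_cycle: "morse_complex (cycle_complex n) = (`) hasse_edge ` {F. admissible F}"
proof
  show "morse_complex (cycle_complex n) \<subseteq> (`) hasse_edge ` {F. admissible F}"
  proof
    fix M assume M: "M \<in> morse_complex (cycle_complex n)"
    then have "M \<subseteq> hasse_edge ` coloured"
      by (simp add: morse_complex_def hasse_matching_def hasse_edges_cycle)
    then obtain F where F: "F \<subseteq> coloured" "M = hasse_edge ` F"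
      by (auto simp: subset_image_iff)
    then have "admissible F"
      using M hasse_matching_iff[OF F(1)] acyclic_hasse_orientation_iff[of F]
      by (simp add: morse_complex_def admissible_def)
    then show "M \<in> (`) hasse_edge ` {F. admissible F}" using F(2) by blast
  qed
  show "(`) hasse_edge ` {F. admissible F} \<subseteq> morse_complex (cycle_complex n)"
    using hasse_matching_iff acyclic_hasse_orientation_iff
    by (auto simp: morse_complex_def admissible_def independent_def)
qed

lemma coloured_eq: "F \<subseteq> coloured \<Longrightarrow> F = Even ` evens F \<union> Odd ` odds F"
  by (auto simp: coloured_def evens_def odds_def)

lemma coloured_bounds: "F \<subseteq> coloured \<Longrightarrow> evens F \<subseteq> {..<n}" "F \<subseteq> coloured \<Longrightarrow> odds F \<subseteq> {..<n}"
  by (auto simp: coloured_def evens_def odds_def)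

lemma card_coloured:
  assumes "F \<subseteq> coloured"
  shows "card F = card (evens F) + card (odds F)"
proof -
  have fin: "finite (evens F)" "finite (odds F)"
    using coloured_bounds[OF assms] finite_subset by blast+
  have "card F = card (Even ` evens F \<union> Odd ` odds F)"
    using coloured_eq[OF assms] by simp
  also have "\<dots> = card (Even ` evens F) + card (Odd ` odds F)"
    using fin by (intro card_Un_disjoint) auto
  also have "\<dots> = card (evens F) + card (odds F)"
    by (simp add: card_image inj_on_def)
  finally show ?thesis .
qed

lemma finite_coloured: "finite coloured"
  by (simp add: coloured_def)

lemma arc_complex_coloured: "F \<in> arc_complex T \<Longrightarrow> F \<subseteq> coloured"
proof
  fix v assume F: "F \<in> arc_complex T" and "v \<in> F"
  have "evens F \<subseteq> {..<n}" "odds F \<subseteq> {..<n}" "mids F = {}" "Top \<notin> F" "Bot \<notin> F"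
    using F arc_subset coarc_subset unfolding arc_complex_def two_coloured_def by blast+
  then show "v \<in> coloured"
    using \<open>v \<in> F\<close> by (cases v) (auto simp: coloured_def evens_def odds_def mids_def)
qed

lemma shift_shift:
  assumes "k < n" "j < n" "l < n"
  shows "shift j l = (if shift k j \<le> shift k l then shift k l - shift k j else shift k l + n - shift k j)"
  using assms by (auto simp: shift_def)

text \<open>
  The neighbours of a proper nonempty set of even nodes are at least one more in number, with
  equality only for the nodes of an arc.
\<close>

lemma admissible_bound:
  assumes F: "admissible F" and E: "evens F \<noteq> {}" and O: "odds F \<noteq> {}"
  shows "card F \<le> n - 1" "card F = n - 1 \<Longrightarrow> F \<in> arc_complex ({..<n} \<times> {..n - 3})"
proof -
  have col: "F \<subseteq> coloured" and ind: "\<And>j. j \<in> odds F \<Longrightarrow> j \<notin> evens F \<and> succ j \<notin> evens F"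
    and ne: "evens F \<noteq> {..<n}"
    using F by (auto simp: admissible_def independent_def)
  note sub = coloured_bounds[OF col]
  have fin: "finite (evens F)" "finite (odds F)"
    using sub finite_subset by blast+
  \<comment> \<open>Just before a block of even indices, \<open>Odd k\<close> is excluded by
    \<open>succ k\<close> although \<open>k\<close> itself is not even. This one index more is the
    reason for the bound \<open>n - 1\<close>.\<close>
  obtain k where k: "k < n" "k \<notin> evens F" "succ k \<in> evens F"
  proof (rule ccontr)
    assume "\<not> thesis"
    then have step: "i \<in> evens F" if "i < n" "succ i \<in> evens F" for i
      using that \<open>\<And>k. k < n \<Longrightarrow> k \<notin> evens F \<Longrightarrow> succ k \<in> evens F \<Longrightarrow> thesis\<close> by blast
    obtain e where "e \<in> evens F" using E by blast
    then have "i \<in> evens F" if "i < n" for i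
      using circle_induct_back[of e "\<lambda>i. i \<in> evens F" i] sub step that by auto
    then show False using ne sub by blast
  qed
  have odds: "odds F \<subseteq> {..<n} - insert k (evens F)"
    using ind k sub by auto
  have "insert k (evens F) \<subseteq> {..<n}" using k sub by auto
  then have card: "card ({..<n} - insert k (evens F)) = n - Suc (card (evens F))"
    using k(2) fin by (subst card_Diff_subset) auto
  have le: "Suc (card (evens F)) \<le> n"
    using card_mono[OF _ \<open>insert k (evens F) \<subseteq> {..<n}\<close>] k(2) fin by simp
  show "card F \<le> n - 1"
    using card_mono[OF _ odds] card le unfolding card_coloured[OF col] by simp
  assume "card F = n - 1"
  then have "card (odds F) = card ({..<n} - insert k (evens F))"
    using card le unfolding card_coloured[OF col] by simp
  then have odds_eq: "odds F = {..<n} - insert k (evens F)"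
    using odds by (intro card_subset_eq) auto
  \<comment> \<open>The circle is cut open at \<open>k\<close>, and \<open>j\<close> becomes the
    first odd index after the cut.\<close>
  define t where "t = shift k"
  obtain j where j: "j \<in> odds F" and min: "\<And>i. i \<in> odds F \<Longrightarrow> t j \<le> t i"
    using O ex_has_least_nat[of "\<lambda>i. i \<in> odds F" _ t] by blast
  have jn: "j < n" using j sub by blast
  have t_less: "t i < n" if "i < n" for i
    using that k(1) by (auto simp: t_def shift_def)
  have t0: "t i = 0 \<longleftrightarrow> i = k" if "i < n" for i
    using that k(1) by (auto simp: t_def shift_def)
  \<comment> \<open>From \<open>j\<close> on, every index is odd: by the equality case an index that
    is neither even nor \<open>k\<close> is odd, and then its successor is not even.\<close>
  have after: "i \<notin> evens F" if "i < n" "t j \<le> t i" for i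
    using that
  proof (induction "t i - t j" arbitrary: i)
    case 0
    then have "t i = t j" by simp
    then have "i = j"
      using 0 k(1) jn by (auto simp: t_def shift_def split: if_splits)
    then show ?case using ind j by blast
  next
    case (Suc d)
    let ?p = "if i = 0 then n - 1 else i - 1"
    have p: "?p < n" "succ ?p = i" using Suc.prems by (auto simp: succ_def)
    have "t i \<noteq> 0" using Suc.hyps(2) by simp
    then have tp: "t ?p = t i - 1"
      using Suc.prems k(1) by (auto simp: t_def shift_def)
    then have "?p \<notin> evens F" using Suc p(1) by auto
    moreover have "?p \<noteq> k"
      using tp t0[OF p(1)] Suc.hyps(2) t0[OF jn] j odds by fastforce
    ultimately have "?p \<in> odds F" using odds_eq p(1) by blast
    then show ?case using ind p(2) by metis
  qed
  have before: "t e < t j" "1 \<le> t e" if "e \<in> evens F" for e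
    using after[of e] that sub t0[of e] k(2) by (force simp: not_less_eq_eq not_le)+
  obtain e where "e \<in> evens F" using E by blast
  \<comment> \<open>An even index lies strictly between \<open>k\<close> and \<open>j\<close>; hence
    the parameter \<open>n - 1 - t j\<close> of the arc is at most \<open>n - 3\<close>.\<close>
  then have tj: "2 \<le> t j" using before by fastforce
  have "two_coloured j (n - 1 - t j) F"
    unfolding two_coloured_def
  proof
    show "odds F \<subseteq> arc j (n - 1 - t j)"
    proof
      fix i assume i: "i \<in> odds F"
      then have "i < n" using sub by auto
      then show "i \<in> arc j (n - 1 - t j)"
        using min[OF i] shift_shift[OF k(1) jn \<open>i < n\<close>] t_less[OF \<open>i < n\<close>]
        by (auto simp: arc_def t_def)
    qed
    show "evens F \<subseteq> coarc j (n - 1 - t j)"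
    proof
      fix i assume i: "i \<in> evens F"
      then have "i < n" using sub by auto
      then show "i \<in> coarc j (n - 1 - t j)"
        using before[OF i] shift_shift[OF k(1) jn \<open>i < n\<close>] t_less[OF jn]
        by (auto simp: coarc_def t_def)
    qed
  qed
  moreover have "(j, n - 1 - t j) \<in> {..<n} \<times> {..n - 3}" using jn tj by auto
  moreover have "mids F = {}" "Top \<notin> F" "Bot \<notin> F"
    using col by (auto simp: coloured_def mids_def)
  ultimately show "F \<in> arc_complex ({..<n} \<times> {..n - 3})"
    unfolding arc_complex_def by blast
qed

lemma admissible_top:
  assumes F: "admissible F"
  shows "card F \<le> n - 1" "card F = n - 1 \<Longrightarrow> F \<in> arc_complex ({..<n} \<times> {..n - 3})"
proof -
  have col: "F \<subseteq> coloured" and ne: "evens F \<noteq> {..<n}" "odds F \<noteq> {..<n}"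
    using F by (auto simp: admissible_def independent_def)
  have sub: "evens F \<subset> {..<n}" "odds F \<subset> {..<n}"
    using coloured_bounds[OF col] ne by auto
  have less: "card (evens F) < n" "card (odds F) < n"
    using sub psubset_card_mono[of "{..<n}"] by auto
  have no: "mids F = {}" "Top \<notin> F" "Bot \<notin> F"
    using col by (auto simp: coloured_def mids_def)
  have "card F \<le> n - 1 \<and> (card F = n - 1 \<longrightarrow> F \<in> arc_complex ({..<n} \<times> {..n - 3}))"
  proof (cases "evens F = {} \<or> odds F = {}")
    case True
    then have "card F \<le> n - 1" using less card_coloured[OF col] by auto
    moreover have "F \<in> arc_complex ({..<n} \<times> {..n - 3})"
      using True sub no unfolding arc_complex_def by blast
    ultimately show ?thesis by blast
  next
    case False
    then show ?thesis using admissible_bound[OF F] by blast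
  qed
  then show "card F \<le> n - 1" "card F = n - 1 \<Longrightarrow> F \<in> arc_complex ({..<n} \<times> {..n - 3})" by blast+
qed

text \<open>The distance from \<open>j\<close> permutes the indices, so arcs and coarcs are counted
  by their ranges of distances.\<close>

lemma card_shift_preimage:
  assumes "j < n" "D \<subseteq> {..<n}"
  shows "card {k. k < n \<and> shift j k \<in> D} = card D"
proof (rule bij_betw_same_card[of "shift j"])
  show "bij_betw (shift j) {k. k < n \<and> shift j k \<in> D} D"
    unfolding bij_betw_def
  proof
    show "inj_on (shift j) {k. k < n \<and> shift j k \<in> D}"
      using assms(1) by (auto simp: inj_on_def shift_def split: if_splits)
    show "shift j ` {k. k < n \<and> shift j k \<in> D} = D"
    proof
      show "D \<subseteq> shift j ` {k. k < n \<and> shift j k \<in> D}"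
      proof
        fix d assume d: "d \<in> D"
        let ?k = "if j + d < n then j + d else j + d - n"
        have "?k < n" "shift j ?k = d"
          using d assms by (auto simp: shift_def)
        then show "d \<in> shift j ` {k. k < n \<and> shift j k \<in> D}"
          using d by (intro image_eqI[of _ _ ?k]) simp_all
      qed
    qed auto
  qed
qed

lemma admissible_extend:
  assumes "F \<subseteq> coloured" "evens F \<subseteq> A" "odds F \<subseteq> B" "A \<subseteq> {..<n}" "B \<subseteq> {..<n}"
    and card: "card A + card B = n - 1" and ind: "\<And>j. j \<in> B \<Longrightarrow> j \<notin> A \<and> succ j \<notin> A"
  obtains G where "F \<subseteq> G" "admissible G" "card G = n - 1"
proof
  let ?G = "Even ` A \<union> Odd ` B"
  have AB: "evens ?G = A" "odds ?G = B" by (auto simp: evens_def odds_def)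
  have G: "?G \<subseteq> coloured" using assms(4,5) by (auto simp: coloured_def)
  show "F \<subseteq> ?G" using coloured_eq[OF assms(1)] assms(2,3) by blast
  show "card ?G = n - 1" using card_coloured[OF G] AB card by simp
  have "A \<noteq> {..<n}" "B \<noteq> {..<n}" using card n_ge_4 by auto
  then show "admissible ?G" using G AB ind by (simp add: admissible_def independent_def)
qed

text \<open>A face of one colour extends to all nodes of that colour but one. Otherwise all of the
  arc and all of the coarc are taken, which have \<open>m + 1\<close> and \<open>n - m - 2\<close>
  nodes.\<close>

lemma arc_complex_extend:
  assumes "F \<in> arc_complex ({..<n} \<times> {..n - 3})"
  obtains G where "F \<subseteq> G" "admissible G" "card G = n - 1"
proof -
  have col: "F \<subseteq> coloured" using assms by (rule arc_complex_coloured)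
  have delete: "card ({..<n} - {i}) = n - 1" if "i < n" for i
    using that by simp
  consider "odds F = {}" "evens F \<subset> {..<n}" | "evens F = {}" "odds F \<subset> {..<n}"
    | j m where "j < n" "m \<le> n - 3" "two_coloured j m F"
    using assms unfolding arc_complex_def by blast
  then show thesis
  proof cases
    case 1
    obtain i where i: "i < n" "i \<notin> evens F"
      using psubset_imp_ex_mem[OF 1(2)] by auto
    show thesis
      by (rule admissible_extend[OF col, of "{..<n} - {i}" "{}"])
        (use 1 i delete[OF i(1)] that in auto)
  next
    case 2
    obtain i where i: "i < n" "i \<notin> odds F"
      using psubset_imp_ex_mem[OF 2(2)] by auto
    show thesis
      by (rule admissible_extend[OF col, of "{}" "{..<n} - {i}"])
        (use 2 i delete[OF i(1)] that in auto)
  next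
    case (3 j m)
    have m: "{..m} \<subseteq> {..<n}" "{m + 2..<n} \<subseteq> {..<n}" using 3(2) n_ge_4 by auto
    have "arc j m = {k. k < n \<and> shift j k \<in> {..m}}"
      by (simp add: arc_def)
    then have "card (arc j m) = Suc m"
      by (simp only: card_shift_preimage[OF 3(1) m(1)] card_atMost)
    moreover have "shift j k < n" if "k < n" for k
      using that 3(1) by (auto simp: shift_def)
    then have "coarc j m = {k. k < n \<and> shift j k \<in> {m + 2..<n}}"
      unfolding coarc_def by (intro Collect_cong) auto
    then have "card (coarc j m) = n - (m + 2)"
      by (simp only: card_shift_preimage[OF 3(1) m(2)] card_atLeastLessThan)
    ultimately have card: "card (coarc j m) + card (arc j m) = n - 1"
      using 3(2) n_ge_4 by simp
    have ind: "k \<notin> coarc j m \<and> succ k \<notin> coarc j m" if "k \<in> arc j m" for k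
      using that 3(1) by (auto simp: arc_def coarc_def shift_def succ_def split: if_splits)
    have "evens F \<subseteq> coarc j m" "odds F \<subseteq> arc j m"
      using 3(3) by (auto simp: two_coloured_def)
    from admissible_extend[OF col this coarc_subset arc_subset card ind] that
    show thesis by metis
  qed
qed

text \<open>By the bound, an admissible set of size \<open>n - 1\<close> is a facet. One exists, as
  the empty face extends to it, so the facets of maximal dimension are exactly these sets.\<close>

lemma pure_morse_complex_cycle:
  "pure_morse_complex (cycle_complex n) = (`) hasse_edge ` arc_complex ({..<n} \<times> {..n - 3})"
proof -
  let ?M = "(`) hasse_edge ` {F. admissible F}"
  have card: "card (hasse_edge ` F) = card F" if "F \<subseteq> coloured" for F
    using inj_on_hasse_edge that by (intro card_image) (rule inj_on_subset)
  have col: "F \<subseteq> coloured" if "admissible F" for F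
    using that by (simp add: admissible_def independent_def)
  have bound: "card M \<le> n - 1" if "M \<in> ?M" for M
    using that card col admissible_top(1) by auto
  have facet: "hasse_edge ` G \<in> facets ?M" if G: "admissible G" "card G = n - 1" for G
    unfolding facets_def
  proof (intro CollectI conjI ballI impI)
    show "hasse_edge ` G \<in> ?M" using G(1) by blast
    fix H assume H: "H \<in> ?M" "hasse_edge ` G \<subseteq> H"
    then obtain G' where "admissible G'" "H = hasse_edge ` G'" by blast
    then have "finite H" using finite_subset[OF col finite_coloured] by simp
    then have "hasse_edge ` G = H"
      using H(2) by (rule card_seteq) (use bound[OF H(1)] card[OF col[OF G(1)]] G(2) in simp)
    then show "H = hasse_edge ` G" ..
  qed
  have in_M: "M \<in> ?M" if "M \<in> facets ?M" for M
    using that by (simp add: facets_def)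
  have "pure_part ?M = (`) hasse_edge ` arc_complex ({..<n} \<times> {..n - 3})"
  proof
    show "pure_part ?M \<subseteq> (`) hasse_edge ` arc_complex ({..<n} \<times> {..n - 3})"
    proof
      fix M assume "M \<in> pure_part ?M"
      then obtain N where N: "N \<in> facets ?M" "\<And>H. H \<in> facets ?M \<Longrightarrow> card H \<le> card N" "M \<subseteq> N"
        unfolding pure_part_def by blast
      obtain G where G: "admissible G" "N = hasse_edge ` G" using in_M[OF N(1)] by blast
      obtain G0 where G0: "admissible G0" "card G0 = n - 1"
        using arc_complex_extend[OF arc_complex_empty] by blast
      have "card G = n - 1"
        using N(2)[OF facet[OF G0]] admissible_top(1)[OF G(1)] card[OF col[OF G(1)]]
          card[OF col[OF G0(1)]] G0(2) G(2) by simp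
      then have "G \<in> arc_complex ({..<n} \<times> {..n - 3})" using admissible_top(2)[OF G(1)] by blast
      moreover obtain F where "F \<subseteq> G" "M = hasse_edge ` F"
        using N(3) G(2) by (auto simp: subset_image_iff)
      ultimately show "M \<in> (`) hasse_edge ` arc_complex ({..<n} \<times> {..n - 3})"
        using finite_complex_mono[OF finite_arc_complex] by blast
    qed
    show "(`) hasse_edge ` arc_complex ({..<n} \<times> {..n - 3}) \<subseteq> pure_part ?M"
    proof
      fix M assume "M \<in> (`) hasse_edge ` arc_complex ({..<n} \<times> {..n - 3})"
      then obtain F where F: "F \<in> arc_complex ({..<n} \<times> {..n - 3})" "M = hasse_edge ` F" by blast
      obtain G where G: "F \<subseteq> G" "admissible G" "card G = n - 1"
        using arc_complex_extend[OF F(1)] .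
      have "card H \<le> card (hasse_edge ` G)" if "H \<in> facets ?M" for H
        using bound[OF in_M[OF that]] card[OF col[OF G(2)]] G(3) by simp
      then show "M \<in> pure_part ?M"
        unfolding pure_part_def using facet[OF G(2,3)] F(2) G(1) by blast
    qed
  qed
  then show ?thesis
    by (simp add: pure_morse_complex_def morse_complex_cycle)
qed

lemma pure_morse_complex_arc_complex:
  "geometric_realization (pure_morse_complex (cycle_complex n)) homeomorphic_space
     geometric_realization (arc_complex ({..<n} \<times> {..n - 3}))"
proof -
  have "\<Union>(arc_complex ({..<n} \<times> {..n - 3})) \<subseteq> coloured"
    using arc_complex_coloured by blast
  then have "inj_on hasse_edge (\<Union>(arc_complex ({..<n} \<times> {..n - 3})))"
    by (rule inj_on_subset[OF inj_on_hasse_edge])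
  then show ?thesis
    unfolding pure_morse_complex_cycle
    by (subst homeomorphic_space_sym) (rule homeomorphic_relabelled_realization[OF finite_arc_complex])
qed

end

theorem theorem6:
  fixes n :: nat
  assumes "n \<ge> 4"
  shows "geometric_realization (pure_morse_complex (cycle_complex n))
    homotopy_equivalent_space wedge_of_spheres [2, n - 2, n - 2]"
proof -
  interpret cycle_size n
    using assms by unfold_locales
  show ?thesis
    using homeomorphic_imp_homotopy_equivalent_space[OF pure_morse_complex_arc_complex]
      arc_complex_wedge
    by (rule homotopy_eqv_trans)
qed

end
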